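(* Let $\mathcal{H}$ be a normalized complete Pick space and let $\rho$ be a bounded non-zero linear functional on $\mathcal{H}$. Then the following are equivalent. (i) $\rho(\varphi g) = \rho(\varphi)\rho(g)$ for all $\varphi \in \mathrm{Mult}(\mathcal{H})$ and all $g \in \mathcal{H}$. (ii) $\rho(fg) = \rho(f)\rho(g)$ whenever $f, g \in \mathcal{H}$ are such that $fg \in \mathcal{H}$.
   Context: $\mathcal{H}$ is a reproducing kernel Hilbert space of complex-valued functions on a set $X$ with reproducing kernel $k$, and it is assumed that $k$ does not vanish on the diagonal. The multiplier algebra is $\mathrm{Mult}(\mathcal{H}) = \{\varphi : X \to \mathbb{C} : \varphi f \in \mathcal{H} \text{ for all } f \in \mathcal{H}\}$; each $\varphi \in \mathrm{Mult}(\mathcal{H})$ gives a bounded multiplication operator $M_\varphi$ on $\mathcal{H}$, and $\|\varphi\|_{\mathrm{Mult}(\mathcal{H})} = \|M_\varphi\|$. $\mathcal{H}$ is normalized if there is a point $x_0 \in X$ such that $k(x,x_0) = 1$ for all $x \in X$. In this case $1 \in \mathcal{H}$, so $\mathrm{Mult}(\mathcal{H}) \subset \mathcal{H}$ and $\rho(\varphi)$ makes sense for $\varphi \in \mathrm{Mult}(\mathcal{H})$. $\mathcal{H}$ is a complete Pick space if for every $r \in \mathbb{N}$ and every finite collection of points $z_1,\ldots,z_n \in X$ and matrices $W_1,\ldots,W_n \in M_r(\mathbb{C})$, positive semidefiniteness of the $nr \times nr$ block matrix $[k(z_i,z_j)(I_{\mathbb{C}^r} - W_i W_j^* )]_{i,j=1}^n$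 implies that there exists $\Phi \in M_r(\mathrm{Mult}(\mathcal{H}))$ of norm at most $1$ (as a multiplication operator on $\mathcal{H} \otimes \mathbb{C}^r$) with $\Phi(z_i) = W_i$ for $i=1,\ldots,n$. *)

theory Defs
  imports "HOL-Analysis.Analysis"
begin

text \<open>
  The set \<open>X\<close> is the type \<^typ>\<open>'x\<close>. A
  Hilbert space of functions on \<open>X\<close> is given by its set \<open>H\<close> of members and its inner product \<open>ip\<close>,
  both of which matter only on \<open>H\<close>. Inner products are linear in the first argument.
\<close>

definition hnorm :: "(('x \<Rightarrow> complex) \<Rightarrow> ('x \<Rightarrow> complex) \<Rightarrow> complex) \<Rightarrow> ('x \<Rightarrow> complex) \<Rightarrow> real" where
  "hnorm ip f = sqrt (Re (ip f f))"

locale function_hilbert_space =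
  fixes H :: "('x \<Rightarrow> complex) set"
    and ip :: "('x \<Rightarrow> complex) \<Rightarrow> ('x \<Rightarrow> complex) \<Rightarrow> complex"
  assumes zero_mem: "(\<lambda>x. 0) \<in> H"
    and add_mem: "\<lbrakk>f \<in> H; g \<in> H\<rbrakk> \<Longrightarrow> (\<lambda>x. f x + g x) \<in> H"
    and scale_mem: "f \<in> H \<Longrightarrow> (\<lambda>x. c * f x) \<in> H"
    and ip_add: "\<lbrakk>f \<in> H; g \<in> H; h \<in> H\<rbrakk> \<Longrightarrow> ip (\<lambda>x. f x + g x) h = ip f h + ip g h"
    and ip_scale: "\<lbrakk>f \<in> H; h \<in> H\<rbrakk> \<Longrightarrow> ip (\<lambda>x. c * f x) h = c * ip f h"
    and ip_cnj: "\<lbrakk>f \<in> H; g \<in> H\<rbrakk> \<Longrightarrow> ip g f = cnj (ip f g)"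
    and ip_nonneg: "f \<in> H \<Longrightarrow> ip f f \<in> \<real>\<^sub>\<ge>\<^sub>0"
    and ip_definite: "\<lbrakk>f \<in> H; ip f f = 0\<rbrakk> \<Longrightarrow> f = (\<lambda>x. 0)"
    and complete:
      "\<lbrakk>\<And>n. F n \<in> H;
        \<And>e. e > 0 \<Longrightarrow> \<exists>N. \<forall>m\<ge>N. \<forall>n\<ge>N. hnorm ip (\<lambda>x. F m x - F n x) < e\<rbrakk>
       \<Longrightarrow> \<exists>f\<in>H. (\<lambda>n. hnorm ip (\<lambda>x. F n x - f x)) \<longlonglongrightarrow> 0"

locale rkhs = function_hilbert_space H ip
  for H :: "('x \<Rightarrow> complex) set"
    and ip :: "('x \<Rightarrow> complex) \<Rightarrow> ('x \<Rightarrow> complex) \<Rightarrow> complex" +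
  fixes k :: "'x \<Rightarrow> 'x \<Rightarrow> complex"
  assumes kernel_mem: "(\<lambda>x. k x y) \<in> H"
    and reproducing: "f \<in> H \<Longrightarrow> ip f (\<lambda>x. k x y) = f y"
    and kernel_diagonal: "k x x \<noteq> 0"

definition Mult :: "('x \<Rightarrow> complex) set \<Rightarrow> ('x \<Rightarrow> complex) set" where
  "Mult H = {\<phi>. \<forall>f\<in>H. (\<lambda>x. \<phi> x * f x) \<in> H}"

definition normalized_kernel :: "('x \<Rightarrow> 'x \<Rightarrow> complex) \<Rightarrow> bool" where
  "normalized_kernel k \<longleftrightarrow> (\<exists>x0. \<forall>x. k x x0 = 1)"

definition pos_semidef :: "'i set \<Rightarrow> ('i \<Rightarrow> 'i \<Rightarrow> complex) \<Rightarrow> bool" where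
  "pos_semidef I A \<longleftrightarrow> (\<forall>v. (\<Sum>p\<in>I. \<Sum>q\<in>I. cnj (v p) * A p q * v q) \<in> \<real>\<^sub>\<ge>\<^sub>0)"

text \<open>
  An \<open>r \<times> r\<close> matrix is a function of two indices, of which only the values at indices
  below \<open>r\<close> matter; an element of \<open>H \<otimes> \<complex>\<^sup>r\<close> is a tuple \<open>h\<close> with \<open>h b \<in> H\<close> for \<open>b < r\<close>, with
  squared norm the sum of the squared norms of its entries.
\<close>

definition contractive_mult_matrix ::
  "('x \<Rightarrow> complex) set \<Rightarrow> (('x \<Rightarrow> complex) \<Rightarrow> ('x \<Rightarrow> complex) \<Rightarrow> complex) \<Rightarrow> nat
    \<Rightarrow> (nat \<Rightarrow> nat \<Rightarrow> 'x \<Rightarrow> complex) \<Rightarrow> bool" where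
  "contractive_mult_matrix H ip r \<Phi> \<longleftrightarrow>
     (\<forall>a<r. \<forall>b<r. \<Phi> a b \<in> Mult H) \<and>
     (\<forall>h. (\<forall>b<r. h b \<in> H) \<longrightarrow>
        sqrt (\<Sum>a<r. (hnorm ip (\<lambda>x. \<Sum>b<r. \<Phi> a b x * h b x))\<^sup>2) \<le> sqrt (\<Sum>b<r. (hnorm ip (h b))\<^sup>2))"

text \<open>
  The block matrix with blocks \<open>k (z i) (z j) (I - W i (W j)\<^sup>*)\<close> has its rows and columns indexed by
  pairs \<open>(i, a)\<close> of a block number \<open>i < n\<close> and a position \<open>a < r\<close> inside the block.
\<close>

definition pick_matrix ::
  "('x \<Rightarrow> 'x \<Rightarrow> complex) \<Rightarrow> nat \<Rightarrow> (nat \<Rightarrow> 'x) \<Rightarrow> (nat \<Rightarrow> nat \<Rightarrow> nat \<Rightarrow> complex)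
    \<Rightarrow> nat \<times> nat \<Rightarrow> nat \<times> nat \<Rightarrow> complex" where
  "pick_matrix k r z W = (\<lambda>(i, a) (j, b).
     k (z i) (z j) * ((if a = b then 1 else 0) - (\<Sum>c<r. W i a c * cnj (W j b c))))"

locale complete_pick_space = rkhs H ip k
  for H :: "('x \<Rightarrow> complex) set"
    and ip :: "('x \<Rightarrow> complex) \<Rightarrow> ('x \<Rightarrow> complex) \<Rightarrow> complex"
    and k :: "'x \<Rightarrow> 'x \<Rightarrow> complex" +
  assumes complete_pick:
    "pos_semidef ({..<n} \<times> {..<r}) (pick_matrix k r z W) \<Longrightarrow>
     \<exists>\<Phi>. contractive_mult_matrix H ip r \<Phi> \<and> (\<forall>i<n. \<forall>a<r. \<forall>b<r. \<Phi> a b (z i) = W i a b)"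

definition bounded_linear_functional ::
  "('x \<Rightarrow> complex) set \<Rightarrow> (('x \<Rightarrow> complex) \<Rightarrow> ('x \<Rightarrow> complex) \<Rightarrow> complex)
    \<Rightarrow> (('x \<Rightarrow> complex) \<Rightarrow> complex) \<Rightarrow> bool" where
  "bounded_linear_functional H ip \<rho> \<longleftrightarrow>
     (\<forall>f\<in>H. \<forall>g\<in>H. \<rho> (\<lambda>x. f x + g x) = \<rho> f + \<rho> g) \<and>
     (\<forall>c. \<forall>f\<in>H. \<rho> (\<lambda>x. c * f x) = c * \<rho> f) \<and>
     (\<exists>C. \<forall>f\<in>H. cmod (\<rho> f) \<le> C * hnorm ip f)"

text \<open>In a normalized space \<open>\<rho> \<phi>\<close> makes sense for every multiplier \<open>\<phi>\<close>.\<close>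

lemma (in rkhs) Mult_subset:
  assumes "normalized_kernel k"
  shows "Mult H \<subseteq> H"
proof
  fix \<phi> assume \<phi>: "\<phi> \<in> Mult H"
  obtain x0 where "\<And>x. k x x0 = 1"
    using assms by (auto simp: normalized_kernel_def)
  then have "(\<lambda>x. 1) \<in> H"
    using kernel_mem[of x0] by simp
  then have "(\<lambda>x. \<phi> x * 1) \<in> H"
    using \<phi> by (fastforce simp: Mult_def)
  then show "\<phi> \<in> H" by simp
qed

end

theory Submission
  imports Defs
begin

text \<open>
  The second condition contains the first because multipliers belong to \<open>H\<close>. For the converse,
  every \<open>f \<in> H\<close> is written as a quotient of multipliers: \<open>multiplier_denominator\<close> provides a
  zero-free multiplier \<open>\<theta>\<close> such that \<open>\<theta> f\<close> is a multiplier and \<open>1 - 2\<theta>\<close> is contractive. If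
  \<open>\<theta>\<close> and \<open>\<eta>\<close> are such denominators for \<open>f\<close> and \<open>g\<close>, then the first condition evaluates
  \<open>\<rho> (\<theta> \<eta> f g)\<close> both as \<open>\<rho> \<theta> \<rho> \<eta> \<rho> (f g)\<close> and as \<open>\<rho> (\<theta> f) \<rho> (\<eta> g) = \<rho> \<theta> \<rho> f \<rho> \<eta> \<rho> g\<close>.
  It remains to cancel \<open>\<rho> \<theta>\<close> and \<open>\<rho> \<eta>\<close>, which are nonzero by \<open>functional_denominator\<close>: a
  contraction \<open>1 - 2\<theta>\<close> that preserves \<open>\<rho>\<close> fixes the vector of least norm with \<open>\<rho> u = 1\<close>,
  whereas \<open>\<theta>\<close> annihilates no nonzero function.

  The denominator is \<open>\<theta> = 1 / (1 + V)\<close>, where \<open>V z = 2 \<langle>f, K\<^sub>z f\<rangle> - \<parallel>f\<parallel>\<^sup>2\<close> with \<open>K\<^sub>z\<close> the kernel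
  function at \<open>z\<close>. When \<open>f\<close> is a combination of kernel functions, \<open>V\<close> is a bounded multiplier and
  \<open>\<parallel>f g\<parallel>\<^sup>2 \<le> Re \<langle>V g, g\<rangle>\<close> for all \<open>g \<in> H\<close> (\<open>sarason_accretive\<close>). Hence \<open>1 + V\<close> is invertible and
  \<open>\<theta>\<close>, \<open>\<theta> f\<close> and \<open>1 - 2\<theta> = (V - 1) / (V + 1)\<close> are contractive multipliers
  (\<open>sarason_resolvent\<close>). These bounds are uniform in \<open>f\<close>, so a pointwise limit along combinations
  of kernel functions converging to a given \<open>f\<close> settles the general case.

  The Pick property enters through \<open>kernel_row\<close>: for finitely many points \<open>z\<close> there is a
  contractive row \<open>\<beta>\<close> of multipliers with \<open>k x z (1 - \<langle>\<beta> x, \<beta> z\<rangle>) = 1\<close> for all \<open>x\<close>. Such rows are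
  built point by point: the relation makes the relevant block of the Pick matrix an all-ones
  matrix, so prescribed values can be interpolated, and \<open>row_rigid\<close> shows that the relation
  then holds on the whole domain. It yields that kernel functions are bounded multipliers, that
  the kernel matrix is a sum of Schur powers of a Gram matrix, and the accretivity estimate.
\<close>

section \<open>Geometry of the Hilbert space and bounded multipliers\<close>

context function_hilbert_space
begin

abbreviation nrm :: "('x \<Rightarrow> complex) \<Rightarrow> real" where "nrm f \<equiv> hnorm ip f"

lemma diff_mem: "\<lbrakk>f \<in> H; g \<in> H\<rbrakk> \<Longrightarrow> (\<lambda>x. f x - g x) \<in> H"
  using add_mem[OF _ scale_mem[of g "-1"], of f] by simp

lemma midpoint_mem: "\<lbrakk>f \<in> H; g \<in> H\<rbrakk> \<Longrightarrow> (\<lambda>x. (f x + g x) / 2) \<in> H"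
  using scale_mem[OF add_mem, of f g "1/2"] by simp

lemma sum_mem: "(\<And>i. i \<in> I \<Longrightarrow> F i \<in> H) \<Longrightarrow> (\<lambda>x. \<Sum>i\<in>I. F i x) \<in> H"
proof (induction I rule: infinite_finite_induct)
  case (insert i I)
  then show ?case using add_mem[of "F i" "\<lambda>x. \<Sum>i\<in>I. F i x"] by simp
qed (simp_all add: zero_mem)

lemma ip_add_right:
  assumes "f \<in> H" "g \<in> H" "h \<in> H"
  shows "ip h (\<lambda>x. f x + g x) = ip h f + ip h g"
  using ip_cnj[OF add_mem[OF assms(1,2)] assms(3)] ip_cnj[OF assms(1,3)] ip_cnj[OF assms(2,3)]
    ip_add[OF assms] by simp

lemma ip_scale_right:
  assumes "f \<in> H" "h \<in> H"
  shows "ip h (\<lambda>x. c * f x) = cnj c * ip h f"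
  using ip_cnj[OF scale_mem[OF assms(1)] assms(2)] ip_cnj[OF assms] ip_scale[OF assms] by simp

lemma ip_diff_left:
  assumes "f \<in> H" "g \<in> H" "h \<in> H"
  shows "ip (\<lambda>x. f x - g x) h = ip f h - ip g h"
  using ip_add[OF assms(1) scale_mem[OF assms(2), of "-1"] assms(3)] ip_scale[OF assms(2,3), of "-1"]
  by simp

lemma ip_diff_right:
  assumes "f \<in> H" "g \<in> H" "h \<in> H"
  shows "ip h (\<lambda>x. f x - g x) = ip h f - ip h g"
  using ip_add_right[OF assms(1) scale_mem[OF assms(2), of "-1"] assms(3)]
    ip_scale_right[OF assms(2,3), of "-1"]
  by simp

lemma ip_zero_left: "h \<in> H \<Longrightarrow> ip (\<lambda>x. 0) h = 0"
  using ip_scale[OF zero_mem, of h 0] by simp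

lemma ip_sum_left:
  assumes "\<And>i. i \<in> I \<Longrightarrow> F i \<in> H" "h \<in> H"
  shows "ip (\<lambda>x. \<Sum>i\<in>I. F i x) h = (\<Sum>i\<in>I. ip (F i) h)"
  using assms(1)
proof (induction I rule: infinite_finite_induct)
  case (insert i I)
  then show ?case
    using ip_add[of "F i" "\<lambda>x. \<Sum>i\<in>I. F i x" h] sum_mem[of I F] assms(2) by simp
qed (simp_all add: ip_zero_left assms(2))

lemma ip_sum_right:
  assumes "\<And>i. i \<in> I \<Longrightarrow> F i \<in> H" "h \<in> H"
  shows "ip h (\<lambda>x. \<Sum>i\<in>I. F i x) = (\<Sum>i\<in>I. ip h (F i))"
proof -
  have "ip h (\<lambda>x. \<Sum>i\<in>I. F i x) = cnj (\<Sum>i\<in>I. ip (F i) h)"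
    using ip_cnj[OF sum_mem assms(2), of I F] ip_sum_left[of I F h] assms by metis
  also have "\<dots> = (\<Sum>i\<in>I. ip h (F i))"
    unfolding cnj_sum
  proof (rule sum.cong)
    fix i assume "i \<in> I"
    then show "cnj (ip (F i) h) = ip h (F i)" using ip_cnj[OF assms(1) assms(2)] by simp
  qed simp
  finally show ?thesis .
qed

lemma ip_self: "f \<in> H \<Longrightarrow> ip f f = of_real ((nrm f)\<^sup>2)"
  using ip_nonneg[of f] by (auto simp: hnorm_def nonneg_Reals_def simp flip: of_real_power)

lemma nrm_sq: "f \<in> H \<Longrightarrow> (nrm f)\<^sup>2 = Re (ip f f)"
  using ip_self[of f] by simp

lemma nrm_nonneg: "f \<in> H \<Longrightarrow> 0 \<le> nrm f"
  using ip_nonneg[of f] by (auto simp: hnorm_def nonneg_Reals_def)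

lemma nrm_eq_0: "\<lbrakk>f \<in> H; nrm f = 0\<rbrakk> \<Longrightarrow> f = (\<lambda>x. 0)"
  using ip_self[of f] ip_definite[of f] by simp

lemma nrm_sq_add:
  assumes "f \<in> H" "g \<in> H"
  shows "(nrm (\<lambda>x. f x + g x))\<^sup>2 = (nrm f)\<^sup>2 + 2 * Re (ip f g) + (nrm g)\<^sup>2"
  using assms ip_cnj[OF assms]
  by (simp add: nrm_sq add_mem ip_add ip_add_right)

lemma nrm_scale: "f \<in> H \<Longrightarrow> nrm (\<lambda>x. c * f x) = cmod c * nrm f"
proof -
  assume f: "f \<in> H"
  have "ip (\<lambda>x. c * f x) (\<lambda>x. c * f x) = (c * cnj c) * ip f f"
    using f by (simp add: ip_scale ip_scale_right scale_mem)
  also have "\<dots> = of_real ((cmod c * nrm f)\<^sup>2)"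
    by (simp only: ip_self[OF f] complex_norm_square[symmetric] power_mult_distrib of_real_mult[symmetric])
  finally show ?thesis
    using nrm_nonneg[OF f] by (simp add: hnorm_def[of ip "\<lambda>x. c * f x"])
qed

lemma nrm_minus: "f \<in> H \<Longrightarrow> nrm (\<lambda>x. - f x) = nrm f"
  using nrm_scale[of f "-1"] by simp

lemma nrm_sq_diff:
  assumes "f \<in> H" "g \<in> H"
  shows "(nrm (\<lambda>x. f x - g x))\<^sup>2 = (nrm f)\<^sup>2 - 2 * Re (ip f g) + (nrm g)\<^sup>2"
  using assms ip_cnj[OF assms]
  by (simp add: nrm_sq diff_mem ip_diff_left ip_diff_right)

lemma nrm_diff_commute: "\<lbrakk>f \<in> H; g \<in> H\<rbrakk> \<Longrightarrow> nrm (\<lambda>x. f x - g x) = nrm (\<lambda>x. g x - f x)"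
  using nrm_minus[OF diff_mem, of f g] by simp

lemma parallelogram:
  assumes "f \<in> H" "g \<in> H"
  shows "(nrm (\<lambda>x. f x - g x))\<^sup>2
    = 2 * (nrm f)\<^sup>2 + 2 * (nrm g)\<^sup>2 - 4 * (nrm (\<lambda>x. (f x + g x) / 2))\<^sup>2"
proof -
  have "nrm (\<lambda>x. (f x + g x) / 2) = nrm (\<lambda>x. f x + g x) / 2"
    using nrm_scale[OF add_mem[OF assms], of "1/2"] by simp
  then show ?thesis
    unfolding \<open>nrm (\<lambda>x. (f x + g x) / 2) = _\<close> nrm_sq_diff[OF assms] power_divide nrm_sq_add[OF assms]
    by (simp add: field_simps)
qed

lemma Cauchy_Schwarz:
  assumes f: "f \<in> H" and g: "g \<in> H"
  shows "cmod (ip f g) \<le> nrm f * nrm g"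
proof (cases "nrm g = 0")
  case True
  then have "g = (\<lambda>x. 0)" using nrm_eq_0 g by blast
  then show ?thesis using ip_cnj[OF zero_mem f] ip_zero_left[OF f] True by simp
next
  case False
  \<comment> \<open>The multiple of \<open>g\<close> that is closest to \<open>f\<close>.\<close>
  define t where "t = ip f g / of_real ((nrm g)\<^sup>2)"
  have "0 \<le> (nrm (\<lambda>x. f x - t * g x))\<^sup>2" by simp
  also have "\<dots> = (nrm f)\<^sup>2 - 2 * Re (cnj t * ip f g) + (cmod t * nrm g)\<^sup>2"
    using f g by (simp add: nrm_sq_diff scale_mem ip_scale_right nrm_scale)
  also have "Re (cnj t * ip f g) = (cmod (ip f g))\<^sup>2 / (nrm g)\<^sup>2"
    by (simp add: t_def mult.commute[of "cnj _"] complex_norm_square[symmetric] flip: of_real_power of_real_divide)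
  also have "(cmod t * nrm g)\<^sup>2 = (cmod (ip f g))\<^sup>2 / (nrm g)\<^sup>2"
    using False by (simp add: t_def norm_divide norm_mult power_mult_distrib power_divide norm_power power2_eq_square)
  finally have "(cmod (ip f g))\<^sup>2 / (nrm g)\<^sup>2 \<le> (nrm f)\<^sup>2" by simp
  then have "(cmod (ip f g))\<^sup>2 \<le> (nrm f * nrm g)\<^sup>2"
    using False by (simp add: divide_le_eq power_mult_distrib)
  then show ?thesis
    using nrm_nonneg[OF f] nrm_nonneg[OF g] by (simp add: power2_le_iff_abs_le)
qed

lemma nrm_triangle:
  assumes "f \<in> H" "g \<in> H"
  shows "nrm (\<lambda>x. f x + g x) \<le> nrm f + nrm g"
proof -
  have "Re (ip f g) \<le> nrm f * nrm g"
    using Cauchy_Schwarz[OF assms] complex_Re_le_cmod[of "ip f g"] by simp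
  then have "(nrm (\<lambda>x. f x + g x))\<^sup>2 \<le> (nrm f + nrm g)\<^sup>2"
    by (simp add: nrm_sq_add[OF assms] power2_sum)
  then show ?thesis
    using nrm_nonneg assms by (simp add: power2_le_iff_abs_le)
qed

lemma nrm_triangle_diff:
  assumes "f \<in> H" "g \<in> H"
  shows "\<bar>nrm f - nrm g\<bar> \<le> nrm (\<lambda>x. f x - g x)"
  using nrm_triangle[OF diff_mem[OF assms] assms(2)]
    nrm_triangle[OF diff_mem[OF assms(2,1)] assms(1)] nrm_diff_commute[OF assms] by simp

lemma nrm_tendsto:
  assumes "\<And>n. F n \<in> H" "v \<in> H" "(\<lambda>n. nrm (\<lambda>x. F n x - v x)) \<longlonglongrightarrow> 0"
  shows "(\<lambda>n. nrm (F n)) \<longlonglongrightarrow> nrm v"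
proof (rule LIM_zero_cancel, rule tendsto_rabs_zero_cancel, rule tendsto_sandwich[OF _ _ tendsto_const assms(3)])
  show "\<forall>\<^sub>F n in sequentially. \<bar>nrm (F n) - nrm v\<bar> \<le> nrm (\<lambda>x. F n x - v x)"
    using nrm_triangle_diff assms by simp
qed simp

text \<open>
  The projection argument for a decreasing sequence of sets closed under midpoints: by the
  parallelogram law, vectors whose norms nearly attain the infima over the sets form a Cauchy
  sequence. With a constant sequence this gives a vector of least norm; with shrinking sets it
  replaces weak compactness of balls.
\<close>

lemma nested_minimal_norm:
  assumes sub: "\<And>n. A n \<subseteq> H"
    and anti: "\<And>n. A (Suc n) \<subseteq> A n"
    and mid: "\<And>n f g. \<lbrakk>f \<in> A n; g \<in> A n\<rbrakk> \<Longrightarrow> (\<lambda>x. (f x + g x) / 2) \<in> A n"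
    and bdd: "\<And>n. \<exists>f\<in>A n. nrm f \<le> C"
  obtains F v where "\<And>n. F n \<in> A n" "v \<in> H" "(\<lambda>n. nrm (\<lambda>x. F n x - v x)) \<longlonglongrightarrow> 0"
    "nrm v \<le> C" "\<And>w. (\<And>n. w \<in> A n) \<Longrightarrow> nrm v \<le> nrm w"
proof -
  define d where "d n = (INF f\<in>A n. (nrm f)\<^sup>2)" for n
  have bb: "bdd_below ((\<lambda>f. (nrm f)\<^sup>2) ` A n)" for n by (rule bdd_belowI[of _ 0]) auto
  have ne: "A n \<noteq> {}" for n using bdd by blast
  have d_le: "d n \<le> (nrm f)\<^sup>2" if "f \<in> A n" for n f
    unfolding d_def using bb that by (rule cINF_lower)
  have C: "0 \<le> C" using bdd[of 0] nrm_nonneg sub[of 0] by force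
  have d_C: "d n \<le> C\<^sup>2" for n
  proof -
    obtain f where f: "f \<in> A n" "nrm f \<le> C" using bdd by blast
    then have "(nrm f)\<^sup>2 \<le> C\<^sup>2" using nrm_nonneg sub by (intro power_mono) auto
    then show ?thesis using d_le[OF f(1)] by simp
  qed
  have d_inc: "incseq d"
    unfolding d_def using bb anti ne by (intro incseq_SucI cINF_superset_mono) auto
  obtain D where D: "d \<longlonglongrightarrow> D" and dD: "\<And>n. d n \<le> D"
    using incseq_convergent[OF d_inc, of "C\<^sup>2"] d_C by blast
  have antiA: "A m \<subseteq> A n" if "n \<le> m" for n m
    using that anti by (rule lift_Suc_antimono_le[rotated])
  have "\<exists>f. f \<in> A n \<and> (nrm f)\<^sup>2 < d n + 1 / real (Suc n)" for n
  proof -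
    have "(INF f\<in>A n. (nrm f)\<^sup>2) < d n + 1 / real (Suc n)" by (simp add: d_def)
    then show ?thesis using cINF_less_iff[OF ne bb] by blast
  qed
  then obtain F where FA: "\<And>n. F n \<in> A n"
    and Fd: "\<And>n. (nrm (F n))\<^sup>2 < d n + 1 / real (Suc n)" by metis
  have FH: "F n \<in> H" for n using FA sub by blast
  have near: "(nrm (\<lambda>x. F n x - F m x))\<^sup>2 \<le> 2 * (D - d N) + 4 / real (Suc N)"
    if "N \<le> n" "n \<le> m" for N n m
  proof -
    \<comment> \<open>Nesting puts the midpoint into the larger set, so the smaller infimum bounds its norm from below.\<close>
    have "d n \<le> (nrm (\<lambda>x. (F n x + F m x) / 2))\<^sup>2"
      using antiA[OF that(2)] FA by (intro d_le mid) auto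
    moreover have "d N \<le> d n" using d_inc that by (simp add: incseqD)
    moreover have "1 / real (Suc n) \<le> 1 / real (Suc N)" "1 / real (Suc m) \<le> 1 / real (Suc N)"
      using that by (simp_all add: frac_le)
    ultimately show ?thesis
      using parallelogram[OF FH FH, of n m] Fd[of n] Fd[of m] dD[of m] by simp
  qed
  have "\<exists>N. \<forall>m\<ge>N. \<forall>n\<ge>N. nrm (\<lambda>x. F m x - F n x) < e" if e: "e > 0" for e
  proof -
    have "(\<lambda>N. 2 * (D - d N) + 4 * (1 / real (Suc N))) \<longlonglongrightarrow> 2 * (D - D) + 4 * 0"
      by (intro tendsto_intros D LIMSEQ_Suc[OF lim_inverse_n'])
    then have "\<forall>\<^sub>F N in sequentially. 2 * (D - d N) + 4 * (1 / real (Suc N)) < e\<^sup>2"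
      using e by (intro order_tendstoD(2)[of _ 0]) auto
    then obtain N where N: "2 * (D - d N) + 4 / real (Suc N) < e\<^sup>2"
      by (auto simp: eventually_sequentially)
    have *: "nrm (\<lambda>x. F n x - F m x) < e" if "N \<le> n" "n \<le> m" for n m
      using power2_less_imp_less[of _ e] near[OF that] N e by auto
    have "nrm (\<lambda>x. F m x - F n x) < e" if "N \<le> n" "N \<le> m" for n m
      using *[of n m] *[of m n] that nrm_diff_commute[OF FH FH, of n m] by (cases "n \<le> m") auto
    then show ?thesis by blast
  qed
  then obtain v where v: "v \<in> H" and lim: "(\<lambda>n. nrm (\<lambda>x. F n x - v x)) \<longlonglongrightarrow> 0"
    using complete[of F] FH by blast
  have "(nrm v)\<^sup>2 \<le> D + 0"
  proof (rule LIMSEQ_le)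
    show "(\<lambda>n. (nrm (F n))\<^sup>2) \<longlonglongrightarrow> (nrm v)\<^sup>2"
      using nrm_tendsto[OF FH v lim] by (intro tendsto_intros)
    show "(\<lambda>n. d n + 1 / real (Suc n)) \<longlonglongrightarrow> D + 0"
      by (intro tendsto_intros D LIMSEQ_Suc[OF lim_inverse_n'])
    show "\<exists>N. \<forall>n\<ge>N. (nrm (F n))\<^sup>2 \<le> d n + 1 / real (Suc n)" using Fd less_imp_le by blast
  qed
  then have vD: "(nrm v)\<^sup>2 \<le> D" by simp
  show ?thesis
  proof (rule that[OF FA v lim])
    have "D \<le> C\<^sup>2" using D d_C by (intro LIMSEQ_le_const2) auto
    then show "nrm v \<le> C" using vD C by (auto intro: power2_le_imp_le[OF order_trans])
    show "nrm v \<le> nrm w" if w: "\<And>n. w \<in> A n" for w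
    proof -
      have "D \<le> (nrm w)\<^sup>2" using D d_le[OF w] by (intro LIMSEQ_le_const2) auto
      then show ?thesis using vD nrm_nonneg[of w] sub w by (auto intro: power2_le_imp_le[OF order_trans])
    qed
  qed
qed

definition mult_bound :: "('x \<Rightarrow> complex) \<Rightarrow> real \<Rightarrow> bool" where
  "mult_bound \<phi> C \<longleftrightarrow> 0 \<le> C \<and> (\<forall>h\<in>H. (\<lambda>x. \<phi> x * h x) \<in> H \<and> nrm (\<lambda>x. \<phi> x * h x) \<le> C * nrm h)"

lemma mult_bound_mem: "\<lbrakk>mult_bound \<phi> C; h \<in> H\<rbrakk> \<Longrightarrow> (\<lambda>x. \<phi> x * h x) \<in> H"
  by (simp add: mult_bound_def)

lemma mult_bound_le: "\<lbrakk>mult_bound \<phi> C; h \<in> H\<rbrakk> \<Longrightarrow> nrm (\<lambda>x. \<phi> x * h x) \<le> C * nrm h"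
  by (simp add: mult_bound_def)

lemma mult_bound_const: "mult_bound (\<lambda>x. c) (cmod c)"
  by (simp add: mult_bound_def scale_mem nrm_scale)

lemma mult_bound_add:
  assumes "mult_bound \<phi> C" "mult_bound \<psi> D"
  shows "mult_bound (\<lambda>x. \<phi> x + \<psi> x) (C + D)"
  unfolding mult_bound_def
proof (intro conjI ballI)
  fix h assume h: "h \<in> H"
  note m = mult_bound_mem[OF assms(1) h] mult_bound_mem[OF assms(2) h]
  show "(\<lambda>x. (\<phi> x + \<psi> x) * h x) \<in> H"
    using add_mem[OF m] by (simp add: distrib_right)
  show "nrm (\<lambda>x. (\<phi> x + \<psi> x) * h x) \<le> (C + D) * nrm h"
    using nrm_triangle[OF m] mult_bound_le[OF assms(1) h] mult_bound_le[OF assms(2) h]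
    by (simp add: distrib_right)
qed (use assms in \<open>simp add: mult_bound_def\<close>)

lemma mult_bound_scale:
  assumes "mult_bound \<phi> C"
  shows "mult_bound (\<lambda>x. c * \<phi> x) (cmod c * C)"
  unfolding mult_bound_def
proof (intro conjI ballI)
  fix h assume h: "h \<in> H"
  note m = mult_bound_mem[OF assms(1) h]
  show "(\<lambda>x. c * \<phi> x * h x) \<in> H"
    using scale_mem[OF m, of c] by (simp add: mult.assoc)
  show "nrm (\<lambda>x. c * \<phi> x * h x) \<le> cmod c * C * nrm h"
    using nrm_scale[OF m, of c] mult_bound_le[OF assms(1) h] 
    by (simp add: mult.assoc mult_left_mono)
qed (use assms in \<open>simp add: mult_bound_def\<close>)

lemma mult_bound_lincomb:
  assumes "\<And>i. i \<in> I \<Longrightarrow> \<exists>C. mult_bound (\<phi> i) C"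
  shows "\<exists>C. mult_bound (\<lambda>x. \<Sum>i\<in>I. a i * \<phi> i x) C"
  using assms
proof (induction I rule: infinite_finite_induct)
  case (insert i I)
  from insert.prems obtain C where "mult_bound (\<phi> i) C" by blast
  moreover from insert.prems insert.IH obtain D where "mult_bound (\<lambda>x. \<Sum>i\<in>I. a i * \<phi> i x) D"
    by blast
  ultimately show ?case
    using mult_bound_add[OF mult_bound_scale, of "\<phi> i" C "\<lambda>x. \<Sum>i\<in>I. a i * \<phi> i x" D "a i"]
      insert.hyps by auto
qed (use mult_bound_const[of 0] in auto)

end

section \<open>Pointwise limits and the span of the kernel functions\<close>

context rkhs
begin

lemma eval_bound: "f \<in> H \<Longrightarrow> cmod (f y) \<le> nrm f * nrm (\<lambda>x. k x y)"
  using Cauchy_Schwarz[OF _ kernel_mem, of f y] reproducing[of f y] by simp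

lemma eval_tendsto:
  assumes "\<And>n. F n \<in> H" "v \<in> H" "(\<lambda>n. nrm (\<lambda>x. F n x - v x)) \<longlonglongrightarrow> 0"
  shows "(\<lambda>n. F n y) \<longlonglongrightarrow> v y"
proof (rule LIM_zero_cancel, rule Lim_null_comparison)
  show "\<forall>\<^sub>F n in sequentially. norm (F n y - v y) \<le> nrm (\<lambda>x. F n x - v x) * nrm (\<lambda>x. k x y)"
    using eval_bound[OF diff_mem[OF assms(1,2)]] by simp
  show "(\<lambda>n. nrm (\<lambda>x. F n x - v x) * nrm (\<lambda>x. k x y)) \<longlonglongrightarrow> 0"
    using assms(3) by (rule tendsto_mult_left_zero)
qed

lemma kernel_sym: "k y x = cnj (k x y)"
  using ip_cnj[OF kernel_mem[of x] kernel_mem[of y]] reproducing[OF kernel_mem[of x], of y]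
    reproducing[OF kernel_mem[of y], of x] by simp

lemma kernel_self: "k x x = of_real ((nrm (\<lambda>y. k y x))\<^sup>2)"
  using reproducing[OF kernel_mem, of x x] ip_self[OF kernel_mem, of x] by simp

lemma kernel_nrm_pos: "0 < nrm (\<lambda>y. k y x)"
  using kernel_self[of x] kernel_diagonal[of x] nrm_nonneg[OF kernel_mem, of x] by force

text \<open>
  Balls of \<open>H\<close> are closed under pointwise limits: a bounded sequence has only one
  possible weak limit, its pointwise one. The weak limit is obtained in norm, by picking
  suitable elements from the convex sets \<open>A n\<close> of functions that are pointwise as close to the
  limit as the tail of the sequence from \<open>n\<close> on.
\<close>

lemma pointwise_limit_mem:
  assumes F: "\<And>n. F n \<in> H" "\<And>n. nrm (F n) \<le> C" and lim: "\<And>x. (\<lambda>n. F n x) \<longlonglongrightarrow> u x"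
  shows "u \<in> H" "nrm u \<le> C"
proof -
  define e where "e n x = (SUP m\<in>{n..}. cmod (F m x - u x))" for n x
  have "(\<lambda>m. cmod (F m x - u x)) \<longlonglongrightarrow> 0" for x
    using lim[of x] by (simp add: LIM_zero tendsto_norm_zero)
  then have "Bseq (\<lambda>m. cmod (F m x - u x))" for x
    by (meson Bseq_def convergentI convergent_imp_Bseq)
  then have bdd: "bdd_above ((\<lambda>m. cmod (F m x - u x)) ` S)" for x S
    by (meson Bseq_bdd_above bdd_above_mono image_mono subset_UNIV)
  have e_ge: "cmod (F m x - u x) \<le> e n x" if "n \<le> m" for n m x
    unfolding e_def using that bdd by (intro cSUP_upper) auto
  have e_dec: "e (Suc n) x \<le> e n x" for n x
    unfolding e_def using bdd by (intro cSUP_subset_mono) auto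
  have e_lim: "(\<lambda>n. e n x) \<longlonglongrightarrow> 0" for x
  proof (rule LIMSEQ_I)
    fix r :: real assume r: "0 < r"
    obtain N where N: "\<And>m. m \<ge> N \<Longrightarrow> cmod (F m x - u x) < r / 2"
      using lim[of x] r unfolding LIMSEQ_iff by (meson half_gt_zero)
    have "norm (e n x - 0) < r" if "n \<ge> N" for n
    proof -
      have "e n x \<le> r / 2" unfolding e_def using N that
        by (intro cSUP_least) (auto intro: less_imp_le dest: order_trans)
      moreover have "0 \<le> e n x" using e_ge[of n n x] norm_ge_zero[of "F n x - u x"] by linarith
      ultimately show ?thesis using r by simp
    qed
    then show "\<exists>N. \<forall>n\<ge>N. norm (e n x - 0) < r" by blast
  qed
  define A where "A n = {v \<in> H. \<forall>x. cmod (v x - u x) \<le> e n x}" for n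
  obtain G v where GA: "\<And>n. G n \<in> A n" and v: "v \<in> H" "(\<lambda>n. nrm (\<lambda>x. G n x - v x)) \<longlonglongrightarrow> 0"
    "nrm v \<le> C"
  proof (rule nested_minimal_norm[of A C])
    show "A n \<subseteq> H" for n by (auto simp: A_def)
    show "A (Suc n) \<subseteq> A n" for n using e_dec by (fastforce simp: A_def intro: order_trans)
    show "\<exists>f\<in>A n. nrm f \<le> C" for n
      using F e_ge by (intro bexI[of _ "F n"]) (auto simp: A_def)
    show "(\<lambda>x. (f x + g x) / 2) \<in> A n" if "f \<in> A n" "g \<in> A n" for n f g
    proof -
      have "cmod ((f x + g x) / 2 - u x) \<le> e n x" for x
      proof -
        have "(f x + g x) / 2 - u x = ((f x - u x) + (g x - u x)) / 2" by (simp add: field_simps)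
        then have "cmod ((f x + g x) / 2 - u x) = cmod ((f x - u x) + (g x - u x)) / 2"
          by (simp only: norm_divide) simp
        also have "\<dots> \<le> (cmod (f x - u x) + cmod (g x - u x)) / 2"
          by (intro divide_right_mono norm_triangle_ineq) simp
        also have "\<dots> \<le> e n x"
          using that[unfolded A_def, simplified, THEN conjunct2, THEN spec, of x] by simp
        finally show ?thesis .
      qed
      then show ?thesis using that by (simp add: A_def midpoint_mem)
    qed
  qed auto
  have "G n \<in> H" for n using GA by (auto simp: A_def)
  then have "(\<lambda>n. G n x) \<longlonglongrightarrow> v x" for x using eval_tendsto v by blast
  moreover have "(\<lambda>n. G n x) \<longlonglongrightarrow> u x" for x
  proof (rule LIM_zero_cancel, rule Lim_null_comparison)
    show "\<forall>\<^sub>F n in sequentially. norm (G n x - u x) \<le> e n x" using GA by (simp add: A_def)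
  qed (rule e_lim)
  ultimately have "v = u" using LIMSEQ_unique by blast
  then show "u \<in> H" "nrm u \<le> C" using v by auto
qed

text \<open>
  The residual of least norm is orthogonal to every kernel function, hence vanishes at every
  point by the reproducing property.
\<close>

lemma kernel_span_dense:
  assumes f: "f \<in> H"
  shows "\<exists>Z a. (\<forall>n. finite (Z n)) \<and> (\<lambda>n. nrm (\<lambda>x. (\<Sum>w\<in>Z n. a n w * k x w) - f x)) \<longlonglongrightarrow> 0"
proof -
  define S where "S = {d. \<exists>Z a. finite Z \<and> d = (\<lambda>x. \<Sum>w\<in>Z. a w * k x w)}"
  have SH: "S \<subseteq> H" by (auto simp: S_def intro!: sum_mem scale_mem kernel_mem)
  have S_add: "(\<lambda>x. d x + t * e x) \<in> S" if "d \<in> S" "e \<in> S" for d e t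
  proof -
    obtain Y b Z c where Y: "finite Y" "d = (\<lambda>x. \<Sum>w\<in>Y. b w * k x w)"
      and Z: "finite Z" "e = (\<lambda>x. \<Sum>w\<in>Z. c w * k x w)" using \<open>d \<in> S\<close> \<open>e \<in> S\<close> unfolding S_def by blast
    have "(\<Sum>w\<in>Y. b w * k x w) = (\<Sum>w\<in>Y \<union> Z. (if w \<in> Y then b w else 0) * k x w)" for x
      using Y Z by (intro sum.mono_neutral_cong_left) auto
    moreover have "(\<Sum>w\<in>Z. c w * k x w) = (\<Sum>w\<in>Y \<union> Z. (if w \<in> Z then c w else 0) * k x w)" for x
      using Y Z by (intro sum.mono_neutral_cong_left) auto
    ultimately have "(\<lambda>x. d x + t * e x)
      = (\<lambda>x. \<Sum>w\<in>Y \<union> Z. ((if w \<in> Y then b w else 0) + t * (if w \<in> Z then c w else 0)) * k x w)"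
      by (simp only: Y(2) Z(2) sum_distrib_left sum.distrib[symmetric] distrib_right mult.assoc)
    moreover have "finite (Y \<union> Z)" using Y(1) Z(1) by simp
    ultimately show ?thesis
      unfolding S_def by (intro CollectI exI[of _ "Y \<union> Z"] exI conjI)
  qed
  have S_kernel: "(\<lambda>x. k x y) \<in> S" for y
    unfolding S_def by (intro CollectI exI[of _ "{y}"] exI[of _ "\<lambda>_. 1"]) simp
  have S_0: "(\<lambda>x. 0) \<in> S"
    unfolding S_def by (intro CollectI exI[of _ "{}"]) simp
  define A where "A (n::nat) = (\<lambda>d x. f x - d x) ` S" for n
  have A_sub: "A n \<subseteq> H" for n using SH f by (auto simp: A_def intro!: diff_mem)
  obtain G v where GA: "\<And>n. G n \<in> A n" and v: "v \<in> H" "(\<lambda>n. nrm (\<lambda>x. G n x - v x)) \<longlonglongrightarrow> 0"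
    and vmin: "\<And>w. w \<in> A 0 \<Longrightarrow> nrm v \<le> nrm w"
  proof (rule nested_minimal_norm[of A "nrm f"])
    show "A n \<subseteq> H" for n by (rule A_sub)
    show "\<exists>f'\<in>A n. nrm f' \<le> nrm f" for n
      unfolding A_def using S_0 by (intro bexI[OF _ imageI[OF S_0]]) simp
    show "(\<lambda>x. (g x + h x) / 2) \<in> A n" if gh: "g \<in> A n" "h \<in> A n" for n g h
    proof -
      obtain d e where "d \<in> S" "e \<in> S" "g = (\<lambda>x. f x - d x)" "h = (\<lambda>x. f x - e x)"
        using gh unfolding A_def by blast
      moreover have "(\<lambda>x. (0 + 1/2 * d x) + 1/2 * e x) \<in> S"
        by (rule S_add[OF S_add[OF S_0 \<open>d \<in> S\<close>] \<open>e \<in> S\<close>])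
      ultimately show ?thesis unfolding A_def 
        by (intro image_eqI[of _ _ "\<lambda>x. (0 + 1/2 * d x) + 1/2 * e x"]) (auto simp: field_simps)
    qed
  qed (auto simp: A_def)
  have GH: "G n \<in> H" for n using GA A_sub by blast
  obtain d where dS: "\<And>n. d n \<in> S" and Gd: "\<And>n. G n = (\<lambda>x. f x - d n x)"
    using GA unfolding A_def image_iff by metis
  have "v y = 0" for y
  proof -
    define K where "K = (nrm (\<lambda>x. k x y))\<^sup>2"
    have K: "0 < K" using kernel_nrm_pos[of y] by (simp add: K_def)
    \<comment> \<open>The multiple of the kernel function at \<open>y\<close> that is closest to \<open>v\<close>.\<close>
    define t where "t = v y / of_real K"
    have km: "(\<lambda>x. t * k x y) \<in> H" by (intro scale_mem kernel_mem)
    have "nrm v \<le> nrm (\<lambda>x. v x - t * k x y)"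
    proof (rule LIMSEQ_le_const)
      show "(\<lambda>n. nrm (\<lambda>x. G n x - t * k x y)) \<longlonglongrightarrow> nrm (\<lambda>x. v x - t * k x y)"
        using v GH km by (intro nrm_tendsto diff_mem) auto
      have "(\<lambda>x. G n x - t * k x y) \<in> A 0" for n
        unfolding A_def Gd using S_add[OF dS S_kernel, of n t y]
        by (intro image_eqI[of _ _ "\<lambda>x. d n x + t * k x y"]) auto
      then show "\<exists>N. \<forall>n\<ge>N. nrm v \<le> nrm (\<lambda>x. G n x - t * k x y)" using vmin by blast
    qed
    then have "(nrm v)\<^sup>2 \<le> (nrm (\<lambda>x. v x - t * k x y))\<^sup>2"
      using v by (intro power_mono nrm_nonneg) auto
    also have "\<dots> = (nrm v)\<^sup>2 - 2 * Re (cnj t * v y) + (cmod t)\<^sup>2 * K"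
      using v km by (simp add: nrm_sq_diff ip_scale_right kernel_mem reproducing nrm_scale
          power_mult_distrib K_def)
    also have "v y = t * of_real K" using K by (simp add: t_def)
    also have "cnj t * (t * of_real K) = of_real ((cmod t)\<^sup>2 * K)"
      using complex_norm_square[of t] by (simp add: mult.commute)
    finally have "(cmod t)\<^sup>2 * K \<le> 0" by (simp add: mult.commute)
    then have "t = 0" using K by (simp add: mult_le_0_iff)
    then show ?thesis using K by (simp add: t_def)
  qed
  then have v0: "v = (\<lambda>x. 0)" by blast
  obtain Z a where "\<And>n. finite (Z n)" "\<And>n. d n = (\<lambda>x. \<Sum>w\<in>Z n. a n w * k x w)"
    using dS unfolding S_def mem_Collect_eq by metis
  moreover have "nrm (\<lambda>x. G n x - v x) = nrm (\<lambda>x. d n x - f x)" for n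
    using nrm_diff_commute[OF f, of "d n"] dS SH by (auto simp: v0 Gd)
  ultimately show ?thesis using v(2) by (intro exI[of _ Z] exI[of _ a]) simp
qed

lemma mult_bound_Mult: "mult_bound \<phi> C \<Longrightarrow> \<phi> \<in> Mult H"
  by (simp add: mult_bound_def Mult_def)

text \<open>
  The Neumann series of the strict contraction \<open>\<tau>\<close> converges pointwise to \<open>1 / (1 - \<tau>)\<close> with
  bounded partial sums, so that the limit is again a multiplier. This needs \<open>\<bar>\<tau>\<bar> \<le> q\<close> pointwise,
  which follows by testing the operator bound on a kernel function.
\<close>

lemma Neumann_mult_bound:
  assumes T: "mult_bound \<tau> q" and q: "q < 1"
  shows "cmod (\<tau> y) \<le> q" "mult_bound (\<lambda>x. 1 / (1 - \<tau> x)) (1 / (1 - q))"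
proof -
  have q0: "0 \<le> q" using T by (simp add: mult_bound_def)
  show *: "cmod (\<tau> y) \<le> q" for y
  proof -
    define N where "N = nrm (\<lambda>x. k x y)"
    have N: "0 < N" using kernel_nrm_pos[of y] by (simp add: N_def)
    have "cmod (\<tau> y * k y y) \<le> nrm (\<lambda>x. \<tau> x * k x y) * N"
      using eval_bound[OF mult_bound_mem[OF T kernel_mem]] by (simp add: N_def)
    also have "\<dots> \<le> (q * N) * N"
      unfolding N_def using mult_bound_le[OF T kernel_mem] N 
      by (intro mult_right_mono) (auto simp: N_def)
    finally have "cmod (\<tau> y) * N\<^sup>2 \<le> q * N\<^sup>2"
      by (simp add: norm_mult kernel_self[of y] N_def[symmetric] power2_eq_square norm_power)
    then show ?thesis using N by simp
  qed
  show "mult_bound (\<lambda>x. 1 / (1 - \<tau> x)) (1 / (1 - q))"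
    unfolding mult_bound_def
  proof (intro conjI ballI)
    fix h assume h: "h \<in> H"
    define F where "F n x = (\<Sum>i<n. \<tau> x ^ i) * h x" for n x
    have pw: "mult_bound (\<lambda>x. \<tau> x ^ i) (q ^ i)" for i
    proof (induction i)
      case 0
      show ?case using mult_bound_const[of 1] by simp
    next
      case (Suc i)
      show ?case unfolding mult_bound_def
      proof (intro conjI ballI)
        fix h assume h: "h \<in> H"
        note m = mult_bound_mem[OF Suc h]
        show "(\<lambda>x. \<tau> x ^ Suc i * h x) \<in> H"
          using mult_bound_mem[OF T m] by (simp add: mult.assoc)
        have "nrm (\<lambda>x. \<tau> x * (\<tau> x ^ i * h x)) \<le> q * (q ^ i * nrm h)"
          using mult_bound_le[OF T m] mult_left_mono[OF mult_bound_le[OF Suc h] q0] by linarith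
        then show "nrm (\<lambda>x. \<tau> x ^ Suc i * h x) \<le> q ^ Suc i * nrm h" by (simp add: mult.assoc)
      qed (use q0 in simp)
    qed
    have part: "mult_bound (\<lambda>x. \<Sum>i<n. \<tau> x ^ i) (\<Sum>i<n. q ^ i)" for n
    proof (induction n)
      case 0
      show ?case using mult_bound_const[of 0] by simp
    next
      case (Suc n)
      show ?case using mult_bound_add[OF Suc pw[of n]] by simp
    qed
    have geo: "(\<Sum>i<n. q ^ i) \<le> 1 / (1 - q)" for n
      using q q0 by (simp add: sum_gp_strict divide_right_mono)
    have "F n \<in> H" "nrm (F n) \<le> 1 / (1 - q) * nrm h" for n
      unfolding F_def
      using mult_bound_mem[OF part h, of n] mult_bound_le[OF part h, of n]
        mult_right_mono[OF geo nrm_nonneg[OF h], of n] by auto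
    moreover have "(\<lambda>n. F n x) \<longlonglongrightarrow> 1 / (1 - \<tau> x) * h x" for x
    proof -
      have "cmod (\<tau> x) < 1" using *[of x] q by simp
      then have "(\<lambda>n. \<Sum>i<n. \<tau> x ^ i) \<longlonglongrightarrow> 1 / (1 - \<tau> x)"
        using geometric_sums[of "\<tau> x"] by (simp add: sums_def)
      then show ?thesis unfolding F_def by (intro tendsto_mult tendsto_const)
    qed
    ultimately show "(\<lambda>x. 1 / (1 - \<tau> x) * h x) \<in> H" "nrm (\<lambda>x. 1 / (1 - \<tau> x) * h x) \<le> 1 / (1 - q) * nrm h"
      using pointwise_limit_mem[of F "1 / (1 - q) * nrm h" "\<lambda>x. 1 / (1 - \<tau> x) * h x"] by blast+
  qed (use q in simp)
qed

end

section \<open>Row contractions representing the kernel\<close>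

lemma sum_nonneg_Reals:
  assumes "\<And>i. i \<in> I \<Longrightarrow> F i \<in> (\<real>\<^sub>\<ge>\<^sub>0 :: complex set)"
  shows "(\<Sum>i\<in>I. F i) \<in> \<real>\<^sub>\<ge>\<^sub>0"
  using assms by (induction I rule: infinite_finite_induct) (auto intro: nonneg_Reals_add_I)

lemma (in function_hilbert_space) ip_lincomb_self:
  assumes "\<And>i. i \<in> I \<Longrightarrow> F i \<in> H"
  shows "ip (\<lambda>x. \<Sum>i\<in>I. a i * F i x) (\<lambda>x. \<Sum>i\<in>I. a i * F i x)
    = (\<Sum>i\<in>I. \<Sum>j\<in>I. cnj (a i) * a j * ip (F j) (F i))"
proof -
  have m: "\<And>i. i \<in> I \<Longrightarrow> (\<lambda>x. a i * F i x) \<in> H" using assms scale_mem by blast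
  have "ip (\<lambda>x. \<Sum>i\<in>I. a i * F i x) (\<lambda>x. \<Sum>i\<in>I. a i * F i x)
    = (\<Sum>i\<in>I. \<Sum>j\<in>I. ip (\<lambda>x. a j * F j x) (\<lambda>x. a i * F i x))"
    using m by (simp add: ip_sum_right sum_mem ip_sum_left)
  also have "\<dots> = (\<Sum>i\<in>I. \<Sum>j\<in>I. cnj (a i) * a j * ip (F j) (F i))"
  proof (intro sum.cong refl)
    fix i j assume "i \<in> I" "j \<in> I"
    then show "ip (\<lambda>x. a j * F j x) (\<lambda>x. a i * F i x) = cnj (a i) * a j * ip (F j) (F i)"
      using assms m by (simp add: ip_scale ip_scale_right)
  qed
  finally show ?thesis .
qed

context function_hilbert_space
begin

definition row_contraction :: "nat \<Rightarrow> (nat \<Rightarrow> 'x \<Rightarrow> complex) \<Rightarrow> bool" where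
  "row_contraction r \<beta> \<longleftrightarrow> (\<forall>h. (\<forall>c<r. h c \<in> H) \<longrightarrow>
     (\<lambda>x. \<Sum>c<r. \<beta> c x * h c x) \<in> H \<and>
     (nrm (\<lambda>x. \<Sum>c<r. \<beta> c x * h c x))\<^sup>2 \<le> (\<Sum>c<r. (nrm (h c))\<^sup>2))"

lemma row_contraction_mem:
  "\<lbrakk>row_contraction r \<beta>; \<And>c. c < r \<Longrightarrow> h c \<in> H\<rbrakk> \<Longrightarrow> (\<lambda>x. \<Sum>c<r. \<beta> c x * h c x) \<in> H"
  by (simp add: row_contraction_def)

lemma row_contraction_le:
  "\<lbrakk>row_contraction r \<beta>; \<And>c. c < r \<Longrightarrow> h c \<in> H\<rbrakk>
    \<Longrightarrow> (nrm (\<lambda>x. \<Sum>c<r. \<beta> c x * h c x))\<^sup>2 \<le> (\<Sum>c<r. (nrm (h c))\<^sup>2)"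
  by (simp add: row_contraction_def)

end

text \<open>
  Only rows are interpolated, written as the first rows of square matrices. The hypothesis on
  \<open>b\<close> makes the block of the Pick matrix that belongs to this first row the all-ones matrix,
  while every other diagonal block is the kernel matrix; both are positive semidefinite.
\<close>

lemma (in complete_pick_space) row_interpolation:
  fixes b :: "'x \<Rightarrow> nat \<Rightarrow> complex"
  assumes Z: "finite Z" and s: "0 < s"
    and b: "\<And>w w'. \<lbrakk>w \<in> Z; w' \<in> Z\<rbrakk> \<Longrightarrow> k w w' * (1 - (\<Sum>c<s. b w c * cnj (b w' c))) = 1"
  shows "\<exists>\<beta>. row_contraction s \<beta> \<and> (\<forall>w\<in>Z. \<forall>c<s. \<beta> c w = b w c)"
proof -
  define n where "n = card Z"
  obtain z where z: "bij_betw z {..<n} Z"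
    using ex_bij_betw_nat_finite[OF Z] by (auto simp: n_def lessThan_atLeast0)
  have zZ: "z i \<in> Z" if "i < n" for i using z that by (auto dest: bij_betwE)
  define W where "W i a c = (if a = 0 then b (z i) c else 0)" for i and a :: nat and c
  define M where "M a i j = (if a = 0 then 1 else k (z i) (z j))" for a :: nat and i j
  have entry: "pick_matrix k s z W (i, a) (j, a') = (if a = a' then M a i j else 0)"
    if "i < n" "j < n" for i j a a'
    using b[OF zZ zZ, OF that] by (auto simp: pick_matrix_def W_def M_def)
  have "pos_semidef ({..<n} \<times> {..<s}) (pick_matrix k s z W)"
    unfolding pos_semidef_def
  proof
    fix v :: "nat \<times> nat \<Rightarrow> complex"
    have "(\<Sum>p\<in>{..<n} \<times> {..<s}. \<Sum>q\<in>{..<n} \<times> {..<s}. cnj (v p) * pick_matrix k s z W p q * v q)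
      = (\<Sum>i<n. \<Sum>a<s. \<Sum>j<n. \<Sum>a'<s. cnj (v (i, a)) * pick_matrix k s z W (i, a) (j, a') * v (j, a'))"
      by (simp only: sum.cartesian_product')
    also have "\<dots> = (\<Sum>i<n. \<Sum>a<s. \<Sum>j<n. \<Sum>a'<s. if a = a' then cnj (v (i, a)) * M a i j * v (j, a) else 0)"
      by (intro sum.cong refl) (auto simp: entry)
    also have "\<dots> = (\<Sum>i<n. \<Sum>a<s. \<Sum>j<n. cnj (v (i, a)) * M a i j * v (j, a))"
      by simp
    also have "\<dots> = (\<Sum>a<s. \<Sum>i<n. \<Sum>j<n. cnj (v (i, a)) * M a i j * v (j, a))"
      by (rule sum.swap)
    also have "\<dots> \<in> \<real>\<^sub>\<ge>\<^sub>0"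
    proof (rule sum_nonneg_Reals)
      fix a
      show "(\<Sum>i<n. \<Sum>j<n. cnj (v (i, a)) * M a i j * v (j, a)) \<in> \<real>\<^sub>\<ge>\<^sub>0"
      proof (cases "a = 0")
        case True
        have "(\<Sum>i<n. \<Sum>j<n. cnj (v (i, a)) * M a i j * v (j, a))
          = cnj (\<Sum>j<n. v (j, a)) * (\<Sum>j<n. v (j, a))"
          by (simp add: True M_def sum_product)
        also have "\<dots> = of_real ((cmod (\<Sum>j<n. v (j, a)))\<^sup>2)"
          by (simp only: complex_norm_square mult.commute)
        finally show ?thesis by (simp only: nonneg_Reals_of_real_iff zero_le_power2)
      next
        case False
        define F where "F = (\<lambda>x. \<Sum>j<n. v (j, a) * k x (z j))"
        have "ip F F = (\<Sum>i<n. \<Sum>j<n. cnj (v (i, a)) * v (j, a) * ip (\<lambda>x. k x (z j)) (\<lambda>x. k x (z i)))"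
          unfolding F_def by (rule ip_lincomb_self) (rule kernel_mem)
        also have "\<dots> = (\<Sum>i<n. \<Sum>j<n. cnj (v (i, a)) * M a i j * v (j, a))"
          using False by (simp add: M_def reproducing kernel_mem mult.commute mult.left_commute)
        finally show ?thesis
          using ip_nonneg[of F] by (simp add: F_def sum_mem scale_mem kernel_mem)
      qed
    qed
    finally show "(\<Sum>p\<in>{..<n} \<times> {..<s}. \<Sum>q\<in>{..<n} \<times> {..<s}. cnj (v p) * pick_matrix k s z W p q * v q) \<in> \<real>\<^sub>\<ge>\<^sub>0" .
  qed
  then obtain \<Phi> where \<Phi>: "contractive_mult_matrix H ip s \<Phi>"
    and val: "\<And>i a c. \<lbrakk>i < n; a < s; c < s\<rbrakk> \<Longrightarrow> \<Phi> a c (z i) = W i a c"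
    using complete_pick by metis
  have "row_contraction s (\<Phi> 0)"
    unfolding row_contraction_def
  proof (intro allI impI conjI)
    fix h assume h: "\<forall>c<s. h c \<in> H"
    show "(\<lambda>x. \<Sum>c<s. \<Phi> 0 c x * h c x) \<in> H"
      using \<Phi> h s by (intro sum_mem) (auto simp: contractive_mult_matrix_def Mult_def)
    have "(nrm (\<lambda>x. \<Sum>c<s. \<Phi> 0 c x * h c x))\<^sup>2 \<le> (\<Sum>a<s. (nrm (\<lambda>x. \<Sum>c<s. \<Phi> a c x * h c x))\<^sup>2)"
      using s by (intro member_le_sum) auto
    also have "\<dots> \<le> (\<Sum>c<s. (nrm (h c))\<^sup>2)"
      using \<Phi> h by (simp add: contractive_mult_matrix_def)
    finally show "(nrm (\<lambda>x. \<Sum>c<s. \<Phi> 0 c x * h c x))\<^sup>2 \<le> (\<Sum>c<s. (nrm (h c))\<^sup>2)" .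
  qed
  moreover have "\<Phi> 0 c w = b w c" if w: "w \<in> Z" and c: "c < s" for w c
  proof -
    obtain i where "i < n" "w = z i" using z w by (auto simp: bij_betw_def)
    then show ?thesis using val[of i 0 c] s c by (simp add: W_def)
  qed
  ultimately show ?thesis by blast
qed

locale normalized_pick_space = complete_pick_space H ip k
  for H :: "('x \<Rightarrow> complex) set"
    and ip :: "('x \<Rightarrow> complex) \<Rightarrow> ('x \<Rightarrow> complex) \<Rightarrow> complex"
    and k :: "'x \<Rightarrow> 'x \<Rightarrow> complex" +
  fixes x0 :: 'x
  assumes kernel_base: "k x x0 = 1"
begin

lemma kernel_base': "k x0 x = 1"
  using kernel_sym[of x0 x] kernel_base by simp

lemma one_mem: "(\<lambda>x. 1) \<in> H"
  using kernel_mem[of x0] kernel_base by simp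

text \<open>
  The function \<open>s\<close> is the row operator times its adjoint, applied to the kernel function at \<open>z\<close>,
  and \<open>u\<close> is that kernel function minus its projection onto the constants. The size of \<open>s\<close>
  and its inner product with \<open>u\<close> decide how far \<open>s\<close> is from \<open>u\<close>.
\<close>

lemma row_kernel:
  fixes \<beta> :: "nat \<Rightarrow> 'x \<Rightarrow> complex" and z :: 'x and r :: nat
  assumes \<beta>: "row_contraction r \<beta>" and \<beta>0: "\<forall>c<r. \<beta> c x0 = 0"
  defines "B \<equiv> \<Sum>c<r. (cmod (\<beta> c z))\<^sup>2" and "N \<equiv> (nrm (\<lambda>x. k x z))\<^sup>2"
    and "s \<equiv> \<lambda>x. \<Sum>c<r. \<beta> c x * (cnj (\<beta> c z) * k x z)" and "u \<equiv> \<lambda>x. k x z - 1"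
  shows "s \<in> H" "u \<in> H" "(nrm s)\<^sup>2 \<le> B * N" "ip s u = of_real (B * N)" "(nrm u)\<^sup>2 = N - 1"
proof -
  have h: "(\<lambda>x. cnj (\<beta> c z) * k x z) \<in> H" for c by (intro scale_mem kernel_mem)
  show s: "s \<in> H" unfolding s_def by (rule row_contraction_mem[OF \<beta>]) (rule h)
  show u: "u \<in> H" unfolding u_def by (intro diff_mem kernel_mem one_mem)
  have ip_u: "ip g u = g z - g x0" if "g \<in> H" for g
    using ip_diff_right[OF kernel_mem[of z] kernel_mem[of x0] that] reproducing[OF that, of z]
      reproducing[OF that, of x0]
    by (simp add: u_def kernel_base)
  have "(nrm s)\<^sup>2 \<le> (\<Sum>c<r. (nrm (\<lambda>x. cnj (\<beta> c z) * k x z))\<^sup>2)"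
    unfolding s_def by (rule row_contraction_le[OF \<beta>]) (rule h)
  also have "\<dots> = B * N"
    by (simp add: nrm_scale kernel_mem power_mult_distrib B_def N_def sum_distrib_right)
  finally show "(nrm s)\<^sup>2 \<le> B * N" .
  have "s z = of_real B * of_real N"
    by (simp add: s_def B_def N_def kernel_self[symmetric] sum_distrib_right mult.assoc[symmetric]
        complex_norm_square flip: of_real_power)
  moreover have "s x0 = 0" by (simp add: s_def \<beta>0)
  ultimately show "ip s u = of_real (B * N)" using ip_u[OF s] by simp
  have "of_real ((nrm u)\<^sup>2) = u z - u x0"
    using ip_u[OF u] ip_self[OF u] by simp
  also have "\<dots> = of_real (N - 1)"
    by (simp add: u_def kernel_base' N_def kernel_self[of z])
  finally show "(nrm u)\<^sup>2 = N - 1" using of_real_eq_iff by blast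
qed

text \<open>
  Cauchy-Schwarz for \<open>s\<close> and \<open>u\<close> of the preceding lemma. The slack in this bound is what an
  additional coordinate of the row at \<open>z\<close> can absorb.
\<close>

lemma row_defect:
  assumes \<beta>: "row_contraction r \<beta>" and \<beta>0: "\<forall>c<r. \<beta> c x0 = 0"
  shows "(\<Sum>c<r. (cmod (\<beta> c z))\<^sup>2) * (nrm (\<lambda>x. k x z))\<^sup>2 \<le> (nrm (\<lambda>x. k x z))\<^sup>2 - 1"
proof -
  define B where "B = (\<Sum>c<r. (cmod (\<beta> c z))\<^sup>2)"
  define N where "N = (nrm (\<lambda>x. k x z))\<^sup>2"
  define s where "s = (\<lambda>x. \<Sum>c<r. \<beta> c x * (cnj (\<beta> c z) * k x z))"
  define u where "u = (\<lambda>x. k x z - 1)"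
  note * = row_kernel[OF \<beta> \<beta>0, of z, folded B_def N_def s_def u_def]
  have BN: "0 \<le> B * N" by (simp add: B_def N_def sum_nonneg)
  have "cmod (ip s u) = B * N"
    using *(4) BN by (simp del: of_real_mult)
  then have "B * N \<le> nrm s * nrm u"
    using Cauchy_Schwarz[OF *(1,2)] by simp
  then have "(B * N)\<^sup>2 \<le> (nrm s)\<^sup>2 * (nrm u)\<^sup>2"
    using BN by (metis power_mono power_mult_distrib)
  also have "\<dots> \<le> (B * N) * (N - 1)"
    unfolding *(5)[symmetric] using *(3) by (intro mult_right_mono) auto
  finally have "(B * N) * (B * N) \<le> (B * N) * (N - 1)" by (simp add: power2_eq_square)
  moreover have "0 \<le> N - 1" unfolding *(5)[symmetric] by simp
  ultimately have "B * N \<le> N - 1"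
    using BN mult_le_cancel_left_pos[of "B * N" "B * N" "N - 1"] by (cases "B * N = 0") linarith+
  then show ?thesis by (simp add: B_def N_def)
qed

text \<open>
  In the extremal case of the preceding bound, \<open>s\<close> and \<open>u\<close> are equal, and evaluating this
  equality at \<open>x\<close> gives the claim. So a relation known at the single point \<open>z\<close> propagates to
  the whole domain.
\<close>

lemma row_rigid:
  assumes \<beta>: "row_contraction r \<beta>" and \<beta>0: "\<forall>c<r. \<beta> c x0 = 0"
    and z: "k z z * (1 - (\<Sum>c<r. \<beta> c z * cnj (\<beta> c z))) = 1"
  shows "k x z * (1 - (\<Sum>c<r. \<beta> c x * cnj (\<beta> c z))) = 1"
proof -
  define B where "B = (\<Sum>c<r. (cmod (\<beta> c z))\<^sup>2)"
  define N where "N = (nrm (\<lambda>x. k x z))\<^sup>2"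
  define s where "s = (\<lambda>x. \<Sum>c<r. \<beta> c x * (cnj (\<beta> c z) * k x z))"
  define u where "u = (\<lambda>x. k x z - 1)"
  note * = row_kernel[OF \<beta> \<beta>0, of z, folded B_def N_def s_def u_def]
  have "(\<Sum>c<r. \<beta> c z * cnj (\<beta> c z)) = of_real B"
    by (simp add: B_def complex_norm_square flip: of_real_power)
  then have "of_real (N * (1 - B)) = (of_real 1 :: complex)"
    using z by (simp add: N_def kernel_self[of z])
  then have NB: "N * (1 - B) = 1" using of_real_eq_iff by blast
  have "(nrm (\<lambda>x. s x - u x))\<^sup>2 = (nrm s)\<^sup>2 - 2 * (B * N) + (N - 1)"
    using nrm_sq_diff[OF *(1,2)] *(4,5) by simp
  also have "\<dots> \<le> 0" using *(3) NB by (simp add: algebra_simps)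
  finally have "nrm (\<lambda>x. s x - u x) = 0" by simp
  then have "(\<lambda>x. s x - u x) = (\<lambda>x. 0)" using nrm_eq_0 diff_mem[OF *(1,2)] by blast
  then have "s x = u x" by (metis eq_iff_diff_eq_0)
  moreover have "s x = k x z * (\<Sum>c<r. \<beta> c x * cnj (\<beta> c z))"
    by (simp add: s_def sum_distrib_left mult.commute mult.left_commute)
  ultimately show ?thesis by (simp add: u_def algebra_simps)
qed

lemma row_base_zero:
  fixes r :: nat
  assumes "k x0 x0 * (1 - (\<Sum>c<r. \<beta> c x0 * cnj (\<beta> c x0))) = 1" "c < r"
  shows "\<beta> c x0 = 0"
proof -
  have "(\<Sum>c<r. \<beta> c x0 * cnj (\<beta> c x0)) = of_real (\<Sum>c<r. (cmod (\<beta> c x0))\<^sup>2)"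
    by (simp add: complex_norm_square flip: of_real_power)
  then have "(of_real (\<Sum>c<r. (cmod (\<beta> c x0))\<^sup>2) :: complex) = 0"
    using assms(1) by (simp add: kernel_base)
  then have "(\<Sum>c<r. (cmod (\<beta> c x0))\<^sup>2) = 0"
    by (simp only: of_real_eq_0_iff)
  then have "\<forall>c\<in>{..<r}. (cmod (\<beta> c x0))\<^sup>2 = 0"
    by (subst (asm) sum_nonneg_eq_0_iff) auto
  then show ?thesis using assms(2) by simp
qed

text \<open>
  The McCullough-Quiggin representation \<open>k = 1 / (1 - \<langle>\<beta>, \<beta>\<rangle>)\<close>, for one of the two arguments in a
  finite set. A new point \<open>y\<close> is included by lengthening the rows by one coordinate that is zero at
  the old points and fills the defect at \<open>y\<close>. The new values satisfy the hypothesis of row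
  interpolation, and rigidity extends the relation to arbitrary \<open>x\<close>.
\<close>

lemma kernel_row:
  assumes "finite Z"
  shows "\<exists>r \<beta>. row_contraction r \<beta> \<and>
    (\<forall>z\<in>insert x0 Z. \<forall>x. k x z * (1 - (\<Sum>c<r. \<beta> c x * cnj (\<beta> c z))) = 1)"
  using assms
proof (induction Z rule: finite_induct)
  case empty
  \<comment> \<open>At the base point the relation holds with the empty row, since the kernel is \<open>1\<close> there.\<close>
  have "row_contraction 0 (\<lambda>_ _. 0)"
    using zero_mem nrm_scale[OF zero_mem, of 0] by (simp add: row_contraction_def)
  then show ?case by (intro exI[of _ 0] exI[of _ "\<lambda>_ _. 0"]) (simp add: kernel_base)
next
  case (insert y Z)
  obtain r \<beta> where \<beta>: "row_contraction r \<beta>"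
    and rel: "\<And>z x. z \<in> insert x0 Z \<Longrightarrow> k x z * (1 - (\<Sum>c<r. \<beta> c x * cnj (\<beta> c z))) = 1"
    using insert.IH by blast
  show ?case
  proof (cases "y = x0")
    case True
    then show ?thesis using \<beta> rel by auto
  next
    case False
    have \<beta>0: "\<forall>c<r. \<beta> c x0 = 0" using row_base_zero[where r = r and \<beta> = \<beta>] rel by blast
    define B where "B = (\<Sum>c<r. (cmod (\<beta> c y))\<^sup>2)"
    define N where "N = (nrm (\<lambda>x. k x y))\<^sup>2"
    have N: "0 < N" using kernel_nrm_pos[of y] by (simp add: N_def)
    \<comment> \<open>The squared modulus of the new coordinate at \<open>y\<close>, chosen so that the relation holds at \<open>(y, y)\<close>.\<close>
    define d where "d = 1 - 1 / N - B"
    have d: "0 \<le> d"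
      using row_defect[OF \<beta> \<beta>0, of y, folded B_def N_def] N by (simp add: d_def field_simps)
    define b where "b w c = (if c < r then \<beta> c w else if w = y then of_real (sqrt d) else 0)" for w c
    have b_sum: "(\<Sum>c<Suc r. b w c * cnj (b w' c))
      = (\<Sum>c<r. \<beta> c w * cnj (\<beta> c w')) + (if w = y \<and> w' = y then of_real d else 0)" for w w'
      using d by (simp add: b_def flip: of_real_mult)
    have b_yy: "k y y * (1 - (\<Sum>c<Suc r. b y c * cnj (b y c))) = 1"
    proof -
      have "(\<Sum>c<Suc r. b y c * cnj (b y c)) = of_real (B + d)"
        unfolding b_sum by (simp add: B_def complex_norm_square flip: of_real_power)
      then have "1 - (\<Sum>c<Suc r. b y c * cnj (b y c)) = of_real (1 / N)"
        by (simp only: d_def) simp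
      then show ?thesis using N by (simp add: kernel_self[of y] N_def[symmetric] flip: of_real_mult of_real_power)
    qed
    have b_rel: "k w w' * (1 - (\<Sum>c<Suc r. b w c * cnj (b w' c))) = 1"
      if "w \<in> insert x0 (insert y Z)" "w' \<in> insert x0 (insert y Z)" for w w'
    proof (cases "w = y \<and> w' = y")
      case True
      then show ?thesis using b_yy by simp
    next
      case F: False
      then have eq: "(\<Sum>c<Suc r. b w c * cnj (b w' c)) = (\<Sum>c<r. \<beta> c w * cnj (\<beta> c w'))"
        unfolding b_sum by auto
      show ?thesis
      proof (cases "w' = y")
        case False
        then show ?thesis unfolding eq using rel[of w' w] that by auto
      next
        case True
        then have w: "w \<in> insert x0 Z" using F that by auto
        have "cnj (k w' w * (1 - (\<Sum>c<r. \<beta> c w' * cnj (\<beta> c w)))) = 1" using rel[OF w, of w'] by simp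
        then show ?thesis unfolding eq by (simp add: kernel_sym[of w w'] mult.commute)
      qed
    qed
    have "\<exists>\<gamma>. row_contraction (Suc r) \<gamma> \<and>
      (\<forall>w\<in>insert x0 (insert y Z). \<forall>c<Suc r. \<gamma> c w = b w c)"
    proof (rule row_interpolation)
      show "finite (insert x0 (insert y Z))" using insert.hyps by simp
    qed (use b_rel in blast)+
    then obtain \<gamma> where \<gamma>: "row_contraction (Suc r) \<gamma>"
      and val: "\<And>w c. \<lbrakk>w \<in> insert x0 (insert y Z); c < Suc r\<rbrakk> \<Longrightarrow> \<gamma> c w = b w c"
      by blast
    have g_rel: "k z z * (1 - (\<Sum>c<Suc r. \<gamma> c z * cnj (\<gamma> c z))) = 1"
      if "z \<in> insert x0 (insert y Z)" for z
    proof -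
      have "(\<Sum>c<Suc r. \<gamma> c z * cnj (\<gamma> c z)) = (\<Sum>c<Suc r. b z c * cnj (b z c))"
        using val[OF that] by (intro sum.cong) auto
      then show ?thesis using b_rel[OF that that] by simp
    qed
    have "\<forall>c<Suc r. \<gamma> c x0 = 0"
      using row_base_zero[where r = "Suc r" and \<beta> = \<gamma>] g_rel by blast
    then have "k x z * (1 - (\<Sum>c<Suc r. \<gamma> c x * cnj (\<gamma> c z))) = 1"
      if "z \<in> insert x0 (insert y Z)" for x z
      using row_rigid[OF \<gamma> _ g_rel[OF that]] by blast
    then show ?thesis using \<gamma> by blast
  qed
qed

end

section \<open>Kernel functions as multipliers and the Schur product\<close>

text \<open>
  Positivity survives entrywise multiplication by a Gram matrix because the Gram matrix is a sum
  of rank-one matrices, each of which only rescales the test vector.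
\<close>

lemma Schur_gram_power:
  fixes P :: "'i \<Rightarrow> 'i \<Rightarrow> complex"
  assumes P: "\<And>a. 0 \<le> Re (\<Sum>i\<in>I. \<Sum>j\<in>I. cnj (a i) * a j * P i j)"
  shows "0 \<le> Re (\<Sum>i\<in>I. \<Sum>j\<in>I. cnj (a i) * a j * ((\<Sum>c<r. b c i * cnj (b c j)) ^ n * P i j))"
proof (induction n arbitrary: a)
  case 0
  then show ?case using P[of a] by simp
next
  case (Suc n)
  define G where "G i j = (\<Sum>c<r. b c i * cnj (b c j))" for i j
  have "(\<Sum>i\<in>I. \<Sum>j\<in>I. cnj (a i) * a j * (G i j ^ Suc n * P i j))
    = (\<Sum>i\<in>I. \<Sum>j\<in>I. \<Sum>c<r. cnj (a i * cnj (b c i)) * (a j * cnj (b c j)) * (G i j ^ n * P i j))"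
  proof (intro sum.cong refl)
    fix i j
    have "cnj (a i) * a j * (G i j ^ Suc n * P i j) = G i j * (cnj (a i) * a j * (G i j ^ n * P i j))"
      by (simp add: mult.left_commute mult.assoc)
    also have "\<dots> = (\<Sum>c<r. cnj (a i * cnj (b c i)) * (a j * cnj (b c j)) * (G i j ^ n * P i j))"
      unfolding G_def[of i j] sum_distrib_right
      by (intro sum.cong refl) (simp add: mult.left_commute mult.assoc)
    finally show "cnj (a i) * a j * (G i j ^ Suc n * P i j)
      = (\<Sum>c<r. cnj (a i * cnj (b c i)) * (a j * cnj (b c j)) * (G i j ^ n * P i j))" .
  qed
  also have "\<dots> = (\<Sum>i\<in>I. \<Sum>c<r. \<Sum>j\<in>I. cnj (a i * cnj (b c i)) * (a j * cnj (b c j)) * (G i j ^ n * P i j))"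
    by (intro sum.cong refl sum.swap)
  also have "\<dots> = (\<Sum>c<r. \<Sum>i\<in>I. \<Sum>j\<in>I. cnj (a i * cnj (b c i)) * (a j * cnj (b c j)) * (G i j ^ n * P i j))"
    by (rule sum.swap)
  finally have eq: "(\<Sum>i\<in>I. \<Sum>j\<in>I. cnj (a i) * a j * (G i j ^ Suc n * P i j))
    = (\<Sum>c<r. \<Sum>i\<in>I. \<Sum>j\<in>I. cnj (a i * cnj (b c i)) * (a j * cnj (b c j)) * (G i j ^ n * P i j))" .
  have "0 \<le> Re (\<Sum>i\<in>I. \<Sum>j\<in>I. cnj (a i * cnj (b c i)) * (a j * cnj (b c j)) * (G i j ^ n * P i j))" for c
    using Suc[of "\<lambda>i. a i * cnj (b c i)"] unfolding G_def .
  then have "0 \<le> Re (\<Sum>i\<in>I. \<Sum>j\<in>I. cnj (a i) * a j * (G i j ^ Suc n * P i j))"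
    unfolding eq Re_sum[of _ "{..<r}"] by (intro sum_nonneg)
  then show ?case unfolding G_def .
qed

context normalized_pick_space
begin

text \<open>
  Here \<open>k x z = 1 / (1 - \<sigma> x)\<close>, where \<open>\<sigma>\<close> pairs the row of \<open>kernel_row\<close> with the constant
  column of its values at \<open>z\<close>. That column has norm less than \<open>1\<close>, and so has multiplication
  by \<open>\<sigma>\<close>.
\<close>

lemma kernel_mult_bound: "\<exists>C. mult_bound (\<lambda>x. k x z) C"
proof -
  obtain r \<beta> where \<beta>: "row_contraction r \<beta>"
    and rel: "\<And>x. k x z * (1 - (\<Sum>c<r. \<beta> c x * cnj (\<beta> c z))) = 1"
    using kernel_row[of "{z}"] by auto
  define B where "B = (\<Sum>c<r. (cmod (\<beta> c z))\<^sup>2)"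
  define \<sigma> where "\<sigma> x = (\<Sum>c<r. \<beta> c x * cnj (\<beta> c z))" for x
  have B0: "0 \<le> B" by (simp add: B_def sum_nonneg)
  have "\<sigma> z = of_real B"
    by (simp add: \<sigma>_def B_def complex_norm_square flip: of_real_power)
  then have "of_real ((nrm (\<lambda>x. k x z))\<^sup>2 * (1 - B)) = (of_real 1 :: complex)"
    using rel[of z] by (simp add: kernel_self[of z] \<sigma>_def)
  then have "(nrm (\<lambda>x. k x z))\<^sup>2 * (1 - B) = 1" using of_real_eq_iff by blast
  then have "0 < (nrm (\<lambda>x. k x z))\<^sup>2 * (1 - B)" by simp
  then have B1: "B < 1" by (simp add: zero_less_mult_iff)
  have "mult_bound \<sigma> (sqrt B)"
    unfolding mult_bound_def
  proof (intro conjI ballI)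
    fix h assume h: "h \<in> H"
    have eq: "(\<lambda>x. \<sigma> x * h x) = (\<lambda>x. \<Sum>c<r. \<beta> c x * (cnj (\<beta> c z) * h x))"
      by (simp add: \<sigma>_def sum_distrib_right mult.assoc)
    have m: "(\<lambda>x. cnj (\<beta> c z) * h x) \<in> H" for c using h by (rule scale_mem)
    show mem: "(\<lambda>x. \<sigma> x * h x) \<in> H"
      unfolding eq by (rule row_contraction_mem[OF \<beta>]) (rule m)
    have "(nrm (\<lambda>x. \<sigma> x * h x))\<^sup>2 \<le> (\<Sum>c<r. (nrm (\<lambda>x. cnj (\<beta> c z) * h x))\<^sup>2)"
      unfolding eq by (rule row_contraction_le[OF \<beta>]) (rule m)
    also have "\<dots> = (sqrt B * nrm h)\<^sup>2"
      using h B0 by (simp add: nrm_scale power_mult_distrib B_def sum_distrib_right)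
    finally show "nrm (\<lambda>x. \<sigma> x * h x) \<le> sqrt B * nrm h"
      using B0 nrm_nonneg[OF h] by (auto intro: power2_le_imp_le)
  qed (use B0 in simp)
  moreover have "sqrt B < 1" using B1 by simp
  ultimately have "mult_bound (\<lambda>x. 1 / (1 - \<sigma> x)) (1 / (1 - sqrt B))" by (rule Neumann_mult_bound)
  moreover have "(\<lambda>x. 1 / (1 - \<sigma> x)) = (\<lambda>x. k x z)"
  proof
    fix x
    have "k x z * (1 - \<sigma> x) = 1" using rel[of x] by (simp add: \<sigma>_def)
    moreover from this have "1 - \<sigma> x \<noteq> 0" by auto
    ultimately show "1 / (1 - \<sigma> x) = k x z" by (rule eq_divide_imp[symmetric, rotated])
  qed
  ultimately show ?thesis by auto
qed

lemma kernel_times_mem: "g \<in> H \<Longrightarrow> (\<lambda>x. k x z * g x) \<in> H"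
  using kernel_mult_bound mult_bound_mem by blast

text \<open>
  The Schur product theorem for the kernel matrix: on \<open>Z\<close> the kernel is the geometric series in
  the Gram matrix of the rows.
\<close>

lemma Schur_kernel:
  assumes rel: "\<And>z x. z \<in> Z \<Longrightarrow> k x z * (1 - (\<Sum>c<r. \<beta> c x * cnj (\<beta> c z))) = 1"
    and P: "\<And>a. 0 \<le> Re (\<Sum>i\<in>Z. \<Sum>j\<in>Z. cnj (a i) * a j * P i j)"
  shows "0 \<le> Re (\<Sum>i\<in>Z. \<Sum>j\<in>Z. cnj (a i) * a j * (k i j * P i j))"
proof -
  define G where "G i j = (\<Sum>c<r. \<beta> c i * cnj (\<beta> c j))" for i j
  define l where "l i = L2_set (\<lambda>c. cmod (\<beta> c i)) {..<r}" for i
  have l: "0 \<le> l i \<and> l i < 1" if "i \<in> Z" for i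
  proof -
    have "(l i)\<^sup>2 = (\<Sum>c<r. (cmod (\<beta> c i))\<^sup>2)"
      by (simp add: l_def L2_set_def sum_nonneg)
    then have "(\<Sum>c<r. \<beta> c i * cnj (\<beta> c i)) = of_real ((l i)\<^sup>2)"
      by (simp add: complex_norm_square flip: of_real_power)
    then have "of_real ((nrm (\<lambda>x. k x i))\<^sup>2 * (1 - (l i)\<^sup>2)) = (of_real 1 :: complex)"
      using rel[OF that, of i] by (simp add: kernel_self[of i])
    then have "(nrm (\<lambda>x. k x i))\<^sup>2 * (1 - (l i)\<^sup>2) = 1" using of_real_eq_iff by blast
    then have "0 < (nrm (\<lambda>x. k x i))\<^sup>2 * (1 - (l i)\<^sup>2)" by simp
    then have "(l i)\<^sup>2 < 1" by (simp add: zero_less_mult_iff)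
    moreover have "0 \<le> l i" by (simp add: l_def)
    ultimately show ?thesis using power2_less_imp_less[of "l i" 1] by simp
  qed
  have G1: "cmod (G i j) < 1" if "i \<in> Z" "j \<in> Z" for i j
  proof -
    have "cmod (G i j) \<le> (\<Sum>c<r. \<bar>cmod (\<beta> c i)\<bar> * \<bar>cmod (\<beta> c j)\<bar>)"
      unfolding G_def by (rule order_trans[OF norm_sum]) (simp add: norm_mult)
    also have "\<dots> \<le> l i * l j" unfolding l_def by (rule L2_set_mult_ineq)
    also have "\<dots> < 1" using l[OF that(1)] l[OF that(2)]
      by (metis mult_less_cancel_right2 mult_less_cancel_left1 mult_strict_mono' mult_1)
    finally show ?thesis .
  qed
  have lim: "(\<lambda>N. \<Sum>n<N. G i j ^ n) \<longlonglongrightarrow> k i j" if "i \<in> Z" "j \<in> Z" for i j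
  proof -
    have "k i j * (1 - G i j) = 1" using rel[OF that(2), of i] by (simp add: G_def)
    moreover from this have "1 - G i j \<noteq> 0" by auto
    ultimately have "k i j = 1 / (1 - G i j)" by (rule eq_divide_imp[rotated])
    then show ?thesis using geometric_sums[OF G1[OF that]] by (simp add: sums_def)
  qed
  have "(\<lambda>N. Re (\<Sum>i\<in>Z. \<Sum>j\<in>Z. cnj (a i) * a j * ((\<Sum>n<N. G i j ^ n) * P i j)))
    \<longlonglongrightarrow> Re (\<Sum>i\<in>Z. \<Sum>j\<in>Z. cnj (a i) * a j * (k i j * P i j))"
    by (intro tendsto_Re tendsto_sum tendsto_mult tendsto_const lim)
  moreover have "0 \<le> Re (\<Sum>i\<in>Z. \<Sum>j\<in>Z. cnj (a i) * a j * ((\<Sum>n<N. G i j ^ n) * P i j))" for N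
  proof (induction N)
    case (Suc N)
    have "0 \<le> Re (\<Sum>i\<in>Z. \<Sum>j\<in>Z. cnj (a i) * a j * (G i j ^ N * P i j))"
      unfolding G_def by (rule Schur_gram_power) (rule P)
    with Suc show ?case by (simp add: distrib_left distrib_right sum.distrib)
  qed simp
  ultimately show ?thesis by (intro LIMSEQ_le_const) auto
qed

section \<open>The Sarason function\<close>

text \<open>
  With \<open>K\<^sub>z\<close> the kernel function at \<open>z\<close>, this is \<open>2 \<langle>f, K\<^sub>z f\<rangle> - \<parallel>f\<parallel>\<^sup>2\<close>, the Sarason function of
  \<open>f\<close>. For the Hardy space it is the Herglotz integral of \<open>\<bar>f\<bar>\<^sup>2\<close> over the circle; its real part,
  the Poisson integral of the same function, dominates \<open>\<bar>f\<bar>\<^sup>2\<close>.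
\<close>

definition sarason :: "('x \<Rightarrow> complex) \<Rightarrow> 'x \<Rightarrow> complex" where
  "sarason f z = 2 * ip f (\<lambda>x. k x z * f x) - of_real ((nrm f)\<^sup>2)"

text \<open>
  For a combination of kernel functions, the Sarason function is again such a combination up to a
  constant, and in particular a multiplier.
\<close>

lemma sarason_span:
  fixes a :: "'x \<Rightarrow> complex"
  assumes "finite Z" and f_def: "f = (\<lambda>x. \<Sum>w\<in>Z. a w * k x w)"
  shows "sarason f = (\<lambda>x. (\<Sum>w\<in>Z. (2 * a w * cnj (f w)) * k x w) + - of_real ((nrm f)\<^sup>2))"
proof
  fix z
  have f: "f \<in> H" unfolding f_def by (intro sum_mem scale_mem kernel_mem)
  note m = kernel_times_mem[OF f, of z]
  have "ip f h = (\<Sum>w\<in>Z. a w * ip (\<lambda>x. k x w) h)" if "h \<in> H" for h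
    unfolding f_def using that by (simp add: ip_sum_left ip_scale scale_mem kernel_mem)
  from this[OF m]
  have "ip f (\<lambda>x. k x z * f x) = (\<Sum>w\<in>Z. a w * ip (\<lambda>x. k x w) (\<lambda>x. k x z * f x))" .
  also have "\<dots> = (\<Sum>w\<in>Z. a w * cnj (f w) * k z w)"
  proof (intro sum.cong refl)
    fix w
    have "ip (\<lambda>x. k x w) (\<lambda>x. k x z * f x) = cnj (k w z * f w)"
      using ip_cnj[OF m kernel_mem[of w]] reproducing[OF m, of w] by simp
    then show "a w * ip (\<lambda>x. k x w) (\<lambda>x. k x z * f x) = a w * cnj (f w) * k z w"
      using kernel_sym[of z w] by simp
  qed
  finally show "sarason f z = (\<Sum>w\<in>Z. (2 * a w * cnj (f w)) * k z w) + - of_real ((nrm f)\<^sup>2)"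
    by (simp add: sarason_def sum_distrib_left mult.assoc)
qed

text \<open>
  The central estimate. Writing \<open>K\<^sub>j\<close> for the kernel function at \<open>j\<close>, the difference of the two sides
  is the real part of \<open>\<Sum> cnj (a i) a j (k i j) P i j\<close>, where
  \<open>P i j = \<langle>\<beta> i, \<beta> j\<rangle> \<langle>K\<^sub>j g, K\<^sub>i g\<rangle> - \<langle>(K\<^sub>j - 1) g, (K\<^sub>i - 1) g\<rangle>\<close>; this uses \<open>k (1 - \<langle>\<beta>, \<beta>\<rangle>) = 1\<close>.
  Since \<open>K\<^sub>j - 1\<close> is the row \<open>\<beta>\<close> applied to the column with entries \<open>cnj (\<beta> c j) K\<^sub>j\<close>,
  positivity of \<open>P\<close> expresses that the row is a contraction, and the factor \<open>k\<close> is harmless by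
  the Schur product theorem.
\<close>

lemma sarason_accretive:
  fixes a :: "'x \<Rightarrow> complex"
  assumes Z: "finite Z" and f_def: "f = (\<lambda>x. \<Sum>w\<in>Z. a w * k x w)" and g: "g \<in> H"
  shows "(nrm (\<lambda>x. f x * g x))\<^sup>2 \<le> Re (ip (\<lambda>x. sarason f x * g x) g)"
proof -
  obtain r \<beta> where \<beta>: "row_contraction r \<beta>"
    and rel: "\<And>z x. z \<in> Z \<Longrightarrow> k x z * (1 - (\<Sum>c<r. \<beta> c x * cnj (\<beta> c z))) = 1"
    using kernel_row[OF Z] by blast
  define G where "G i j = (\<Sum>c<r. \<beta> c i * cnj (\<beta> c j))" for i j
  define K where "K j = (\<lambda>x. k x j * g x)" for j
  have KH: "K j \<in> H" for j unfolding K_def using g by (rule kernel_times_mem)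
  define U where "U j = (\<lambda>x. K j x - g x)" for j
  have UH: "U j \<in> H" for j unfolding U_def using KH g by (intro diff_mem)
  define P where "P i j = G i j * ip (K j) (K i) - ip (U j) (U i)" for i j
  have P_nonneg: "0 \<le> Re (\<Sum>i\<in>Z. \<Sum>j\<in>Z. cnj (b i) * b j * P i j)" for b
  proof -
    define h where "h c = (\<lambda>x. \<Sum>j\<in>Z. (b j * cnj (\<beta> c j)) * K j x)" for c
    have h: "h c \<in> H" for c unfolding h_def by (intro sum_mem scale_mem KH)
    define u where "u = (\<lambda>x. \<Sum>j\<in>Z. b j * U j x)"
    have uH: "u \<in> H" unfolding u_def by (intro sum_mem scale_mem UH)
    have "(\<Sum>c<r. \<beta> c x * h c x) = u x" for x
    proof -
      have "(\<Sum>c<r. \<beta> c x * h c x) = (\<Sum>c<r. \<Sum>j\<in>Z. b j * (\<beta> c x * cnj (\<beta> c j)) * K j x)"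
        unfolding h_def sum_distrib_left by (intro sum.cong refl) (simp add: mult.left_commute mult.assoc)
      also have "\<dots> = (\<Sum>j\<in>Z. \<Sum>c<r. b j * (\<beta> c x * cnj (\<beta> c j)) * K j x)" by (rule sum.swap)
      also have "\<dots> = (\<Sum>j\<in>Z. b j * G x j * K j x)"
        by (simp add: G_def sum_distrib_left sum_distrib_right)
      also have "\<dots> = u x"
        unfolding u_def
      proof (intro sum.cong refl)
        fix j assume "j \<in> Z"
        then have "k x j * G x j = k x j - 1" using rel[of j x] by (simp add: G_def algebra_simps)
        then have "G x j * K j x = U j x" by (simp add: K_def U_def mult.assoc[symmetric] mult.commute[of "G x j"] left_diff_distrib)
        then show "b j * G x j * K j x = b j * U j x" by (simp add: mult.assoc)
      qed
      finally show ?thesis .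
    qed
    then have "(nrm u)\<^sup>2 \<le> (\<Sum>c<r. (nrm (h c))\<^sup>2)"
      using row_contraction_le[OF \<beta>, of h] h by simp
    also have "\<dots> = Re (\<Sum>c<r. ip (h c) (h c))"
      using h by (simp add: nrm_sq)
    also have "(\<Sum>c<r. ip (h c) (h c))
      = (\<Sum>c<r. \<Sum>i\<in>Z. \<Sum>j\<in>Z. cnj (b i) * b j * (\<beta> c i * cnj (\<beta> c j)) * ip (K j) (K i))"
      unfolding h_def
      by (intro sum.cong refl, subst ip_lincomb_self[OF KH]) (simp add: mult.left_commute mult.assoc)
    also have "\<dots> = (\<Sum>i\<in>Z. \<Sum>c<r. \<Sum>j\<in>Z. cnj (b i) * b j * (\<beta> c i * cnj (\<beta> c j)) * ip (K j) (K i))"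
      by (rule sum.swap)
    also have "\<dots> = (\<Sum>i\<in>Z. \<Sum>j\<in>Z. \<Sum>c<r. cnj (b i) * b j * (\<beta> c i * cnj (\<beta> c j)) * ip (K j) (K i))"
      by (intro sum.cong refl sum.swap)
    also have "\<dots> = (\<Sum>i\<in>Z. \<Sum>j\<in>Z. cnj (b i) * b j * (G i j * ip (K j) (K i)))"
      by (simp add: G_def sum_distrib_left sum_distrib_right mult.assoc)
    also have "(nrm u)\<^sup>2 = Re (\<Sum>i\<in>Z. \<Sum>j\<in>Z. cnj (b i) * b j * ip (U j) (U i))"
      unfolding nrm_sq[OF uH] unfolding u_def by (subst ip_lincomb_self[OF UH]) simp
    finally show ?thesis
      by (simp only: P_def right_diff_distrib sum_subtractf minus_complex.simps diff_ge_0_iff_ge)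
  qed
  have f: "f \<in> H" unfolding f_def by (intro sum_mem scale_mem kernel_mem)
  define L where "L j = ip (K j) g" for j
  have kP: "k i j * P i j = k i j * L j + k i j * cnj (L i) - k i j * ip g g - ip (K j) (K i)"
    if "i \<in> Z" "j \<in> Z" for i j
  proof -
    have kG: "k i j * G i j = k i j - 1" using rel[OF that(2), of i] by (simp add: G_def algebra_simps)
    have ipU: "ip (U j) (U i) = ip (K j) (K i) - L j - cnj (L i) + ip g g"
      unfolding U_def using KH g ip_cnj[OF KH g]
      by (simp add: ip_diff_left ip_diff_right diff_mem L_def)
    have "k i j * P i j = (k i j * G i j) * ip (K j) (K i) - k i j * ip (U j) (U i)"
      by (simp add: P_def algebra_simps)
    then show ?thesis unfolding kG ipU by (simp add: algebra_simps)
  qed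
  have cnj_f: "(\<Sum>i\<in>Z. cnj (a i) * k i j) = cnj (f j)" for j
    unfolding f_def cnj_sum
  proof (intro sum.cong refl)
    fix i show "cnj (a i) * k i j = cnj (a i * k j i)" using kernel_sym[of i j] by simp
  qed
  have ip_ff: "(\<Sum>i\<in>Z. \<Sum>j\<in>Z. cnj (a i) * a j * k i j) = of_real ((nrm f)\<^sup>2)"
    unfolding ip_self[OF f, symmetric] unfolding f_def
    by (subst ip_lincomb_self) (simp_all add: kernel_mem reproducing)
  have fgH: "(\<lambda>x. \<Sum>j\<in>Z. a j * K j x) \<in> H" by (intro sum_mem scale_mem KH)
  have fg: "(\<lambda>x. f x * g x) = (\<lambda>x. \<Sum>j\<in>Z. a j * K j x)"
    by (simp add: f_def K_def sum_distrib_right mult.assoc)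
  have ip_fg: "(\<Sum>i\<in>Z. \<Sum>j\<in>Z. cnj (a i) * a j * ip (K j) (K i)) = of_real ((nrm (\<lambda>x. f x * g x))\<^sup>2)"
    unfolding fg ip_self[OF fgH, symmetric] by (rule ip_lincomb_self[OF KH, symmetric])
  define A where "A = (\<Sum>j\<in>Z. a j * cnj (f j) * L j)"
  have S1: "(\<Sum>i\<in>Z. \<Sum>j\<in>Z. cnj (a i) * a j * (k i j * L j)) = A"
  proof -
    have "(\<Sum>i\<in>Z. \<Sum>j\<in>Z. cnj (a i) * a j * (k i j * L j)) = (\<Sum>j\<in>Z. \<Sum>i\<in>Z. a j * (cnj (a i) * k i j) * L j)"
      by (subst sum.swap) (simp add: mult.left_commute mult.assoc)
    also have "\<dots> = A"
      by (simp add: A_def sum_distrib_left[symmetric] sum_distrib_right[symmetric] cnj_f)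
    finally show ?thesis .
  qed
  have S2: "(\<Sum>i\<in>Z. \<Sum>j\<in>Z. cnj (a i) * a j * (k i j * cnj (L i))) = cnj A"
  proof -
    have "(\<Sum>i\<in>Z. \<Sum>j\<in>Z. cnj (a i) * a j * (k i j * cnj (L i))) = (\<Sum>i\<in>Z. cnj (a i) * f i * cnj (L i))"
      by (simp add: f_def sum_distrib_left sum_distrib_right mult.assoc)
    also have "\<dots> = cnj A" by (simp add: A_def)
    finally show ?thesis .
  qed
  have S3: "(\<Sum>i\<in>Z. \<Sum>j\<in>Z. cnj (a i) * a j * (k i j * ip g g)) = of_real ((nrm f)\<^sup>2) * ip g g"
    unfolding ip_ff[symmetric] sum_distrib_right by (simp add: mult.assoc)
  have "0 \<le> Re (\<Sum>i\<in>Z. \<Sum>j\<in>Z. cnj (a i) * a j * (k i j * P i j))"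
    using rel P_nonneg by (rule Schur_kernel)
  also have "(\<Sum>i\<in>Z. \<Sum>j\<in>Z. cnj (a i) * a j * (k i j * P i j))
    = (\<Sum>i\<in>Z. \<Sum>j\<in>Z. cnj (a i) * a j * (k i j * L j) + cnj (a i) * a j * (k i j * cnj (L i))
        - cnj (a i) * a j * (k i j * ip g g) - cnj (a i) * a j * ip (K j) (K i))"
    by (intro sum.cong refl) (simp add: kP right_diff_distrib distrib_left)
  also have "\<dots> = A + cnj A - of_real ((nrm f)\<^sup>2) * ip g g - of_real ((nrm (\<lambda>x. f x * g x))\<^sup>2)"
    unfolding sum_subtractf sum.distrib S1 S2 S3 ip_fg ..
  finally have main: "(nrm (\<lambda>x. f x * g x))\<^sup>2 \<le> 2 * Re A - Re (of_real ((nrm f)\<^sup>2) * ip g g)"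
    by simp
  have "(\<lambda>x. sarason f x * g x) = (\<lambda>x. (\<Sum>j\<in>Z. (2 * a j * cnj (f j)) * K j x) - of_real ((nrm f)\<^sup>2) * g x)"
    unfolding sarason_span[OF Z f_def]
    by (simp add: K_def sum_distrib_right left_diff_distrib mult.assoc)
  then have "ip (\<lambda>x. sarason f x * g x) g = (\<Sum>j\<in>Z. (2 * a j * cnj (f j)) * L j) - of_real ((nrm f)\<^sup>2) * ip g g"
    using g by (simp add: ip_diff_left ip_sum_left ip_scale sum_mem scale_mem KH L_def)
  also have "\<dots> = 2 * A - of_real ((nrm f)\<^sup>2) * ip g g"
    by (simp add: A_def sum_distrib_left mult.assoc)
  finally show ?thesis using main by simp
qed

text \<open>
  The real part of multiplication by the Sarason function \<open>V\<close> is nonnegative, so \<open>1 + V\<close> is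
  invertible. With \<open>g = \<theta> h\<close> one has
  \<open>\<parallel>h\<parallel>\<^sup>2 = \<parallel>g\<parallel>\<^sup>2 + 2 Re \<langle>V g, g\<rangle> + \<parallel>V g\<parallel>\<^sup>2\<close>, which dominates \<open>\<parallel>g\<parallel>\<^sup>2\<close>, \<open>\<parallel>f g\<parallel>\<^sup>2\<close> and
  \<open>\<parallel>(V - 1) g\<parallel>\<^sup>2\<close>. The bounds do not depend on \<open>f\<close>, which allows passage to limits.
\<close>

lemma sarason_resolvent:
  fixes a :: "'x \<Rightarrow> complex"
  assumes Z: "finite Z" and f_def: "f = (\<lambda>x. \<Sum>w\<in>Z. a w * k x w)"
  defines "\<theta> \<equiv> \<lambda>x. 1 / (1 + sarason f x)"
  shows "0 \<le> Re (sarason f y)"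
    and "mult_bound \<theta> 1" "mult_bound (\<lambda>x. \<theta> x * f x) 1" "mult_bound (\<lambda>x. 1 - 2 * \<theta> x) 1"
proof -
  let ?V = "sarason f"
  have acc: "(nrm (\<lambda>x. f x * g x))\<^sup>2 \<le> Re (ip (\<lambda>x. ?V x * g x) g)" if "g \<in> H" for g
    using Z f_def that by (rule sarason_accretive)
  obtain M1 where M1: "mult_bound (\<lambda>x. \<Sum>w\<in>Z. (2 * a w * cnj (f w)) * k x w) M1"
    using mult_bound_lincomb[of Z "\<lambda>w x. k x w" "\<lambda>w. 2 * a w * cnj (f w)"] kernel_mult_bound by blast
  obtain M where V: "mult_bound ?V M"
    using mult_bound_add[OF M1 mult_bound_const[of "- of_real ((nrm f)\<^sup>2)"]]
    unfolding sarason_span[OF Z f_def] by blast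
  have M0: "0 \<le> M" using V by (simp add: mult_bound_def)
  obtain F where F: "mult_bound f F"
    using mult_bound_lincomb[of Z "\<lambda>w x. k x w" a] kernel_mult_bound unfolding f_def by blast
  note fm = mult_bound_mem[OF F] and Vm = mult_bound_mem[OF V]
  show Re_V: "0 \<le> Re (?V y)" for y
  proof -
    have "ip (\<lambda>x. ?V x * k x y) (\<lambda>x. k x y) = ?V y * of_real ((nrm (\<lambda>x. k x y))\<^sup>2)"
      using reproducing[OF Vm[OF kernel_mem], of y] kernel_self[of y] by simp
    then have "(nrm (\<lambda>x. f x * k x y))\<^sup>2 \<le> Re (?V y) * (nrm (\<lambda>x. k x y))\<^sup>2"
      using acc[OF kernel_mem[of y]] by simp
    then have "0 \<le> Re (?V y) * (nrm (\<lambda>x. k x y))\<^sup>2" by (rule order_trans[OF zero_le_power2])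
    then show ?thesis using kernel_nrm_pos[of y] by (simp add: zero_le_mult_iff)
  qed
  have V1: "1 + ?V x \<noteq> 0" for x
  proof
    assume "1 + ?V x = 0"
    then have "Re (1 + ?V x) = 0" by simp
    then show False using Re_V[of x] by simp
  qed
  \<comment> \<open>Large enough that \<open>\<tau> = 1 - (1 + V) / c\<close> is a strict contraction: by accretivity its squared
    norm is at most \<open>((c - 1)\<^sup>2 + M\<^sup>2) / c\<^sup>2\<close>.\<close>
  define c where "c = M\<^sup>2 / 2 + 1"
  have c: "1 \<le> c" by (simp add: c_def)
  define q where "q = sqrt ((c - 1)\<^sup>2 + M\<^sup>2) / c"
  have q0: "0 \<le> q" using c by (simp add: q_def)
  have "(c - 1)\<^sup>2 + M\<^sup>2 < c\<^sup>2" by (simp add: c_def power2_eq_square algebra_simps)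
  then have "sqrt ((c - 1)\<^sup>2 + M\<^sup>2) < c" using c real_sqrt_less_mono by fastforce
  then have q1: "q < 1" using c by (simp add: q_def)
  define \<tau> where "\<tau> x = (of_real (c - 1) - ?V x) / of_real c" for x
  have "mult_bound \<tau> q"
    unfolding mult_bound_def
  proof (intro conjI ballI)
    fix h assume h: "h \<in> H"
    define w where "w = (\<lambda>x. of_real (c - 1) * h x - ?V x * h x)"
    have wH: "w \<in> H" unfolding w_def by (intro diff_mem scale_mem Vm h)
    have eq: "(\<lambda>x. \<tau> x * h x) = (\<lambda>x. (1 / of_real c) * w x)"
      by (simp add: \<tau>_def w_def left_diff_distrib)
    show "(\<lambda>x. \<tau> x * h x) \<in> H" unfolding eq using wH by (rule scale_mem)
    have "Re (ip (\<lambda>x. of_real (c - 1) * h x) (\<lambda>x. ?V x * h x)) = (c - 1) * Re (ip (\<lambda>x. ?V x * h x) h)"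
      using ip_scale[OF h Vm[OF h], of "of_real (c - 1)"] ip_cnj[OF Vm[OF h] h] by simp
    then have "(nrm w)\<^sup>2 = (c - 1)\<^sup>2 * (nrm h)\<^sup>2 - 2 * ((c - 1) * Re (ip (\<lambda>x. ?V x * h x) h))
        + (nrm (\<lambda>x. ?V x * h x))\<^sup>2"
      unfolding w_def
      by (subst nrm_sq_diff[OF scale_mem[OF h] Vm[OF h]], subst nrm_scale[OF h])
        (simp add: power_mult_distrib flip: of_real_diff)
    moreover have "0 \<le> (c - 1) * Re (ip (\<lambda>x. ?V x * h x) h)"
      using acc[OF h] zero_le_power2[of "nrm (\<lambda>x. f x * h x)"] c by (intro mult_nonneg_nonneg) linarith+
    moreover have "(nrm (\<lambda>x. ?V x * h x))\<^sup>2 \<le> M\<^sup>2 * (nrm h)\<^sup>2"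
      using mult_bound_le[OF V h] nrm_nonneg[OF Vm[OF h]] by (metis power_mono power_mult_distrib)
    ultimately have "(nrm w)\<^sup>2 \<le> ((c - 1)\<^sup>2 + M\<^sup>2) * (nrm h)\<^sup>2" by (simp add: distrib_right)
    also have "\<dots> = (sqrt ((c - 1)\<^sup>2 + M\<^sup>2) * nrm h)\<^sup>2" by (simp add: power_mult_distrib)
    finally have "nrm w \<le> sqrt ((c - 1)\<^sup>2 + M\<^sup>2) * nrm h"
      using nrm_nonneg[OF h] by (auto intro: power2_le_imp_le)
    then have "nrm w / c \<le> sqrt ((c - 1)\<^sup>2 + M\<^sup>2) * nrm h / c"
      using c by (intro divide_right_mono) auto
    then show "nrm (\<lambda>x. \<tau> x * h x) \<le> q * nrm h"
      unfolding eq nrm_scale[OF wH] using c by (simp add: q_def norm_divide)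
  qed (rule q0)
  then have "mult_bound (\<lambda>x. (1 / of_real c) * (1 / (1 - \<tau> x))) (cmod (1 / of_real c) * (1 / (1 - q)))"
    using q1 by (intro mult_bound_scale Neumann_mult_bound)
  moreover have "(1 / of_real c) * (1 / (1 - \<tau> x)) = \<theta> x" for x
  proof -
    have "of_real c * \<tau> x = of_real (c - 1) - ?V x" using c by (simp add: \<tau>_def)
    then have "of_real c * (1 - \<tau> x) = 1 + ?V x" by (simp add: right_diff_distrib)
    then show ?thesis unfolding \<theta>_def by (simp only: times_divide_times_eq mult_1)
  qed
  ultimately have \<theta>m: "(\<lambda>x. \<theta> x * h x) \<in> H" if "h \<in> H" for h
    using mult_bound_mem[OF _ that] by simp
  have key: "(nrm h)\<^sup>2 = (nrm g)\<^sup>2 + 2 * Re (ip (\<lambda>x. ?V x * g x) g) + (nrm (\<lambda>x. ?V x * g x))\<^sup>2"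
      "(nrm (\<lambda>x. (1 - 2 * \<theta> x) * h x))\<^sup>2
        = (nrm g)\<^sup>2 - 2 * Re (ip (\<lambda>x. ?V x * g x) g) + (nrm (\<lambda>x. ?V x * g x))\<^sup>2"
      "(\<lambda>x. (1 - 2 * \<theta> x) * h x) \<in> H"
    if h: "h \<in> H" and g_def: "g = (\<lambda>x. \<theta> x * h x)" for g h
  proof -
    have g: "g \<in> H" unfolding g_def using h by (rule \<theta>m)
    have gh: "(1 + ?V x) * g x = h x" for x using V1[of x] by (simp add: g_def \<theta>_def)
    then have "(\<lambda>x. ?V x * g x + g x) = h" by (simp add: fun_eq_iff algebra_simps)
    then show "(nrm h)\<^sup>2 = (nrm g)\<^sup>2 + 2 * Re (ip (\<lambda>x. ?V x * g x) g) + (nrm (\<lambda>x. ?V x * g x))\<^sup>2"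
      using nrm_sq_add[OF Vm[OF g] g] by simp
    have "(\<lambda>x. ?V x * g x - g x) = (\<lambda>x. (1 - 2 * \<theta> x) * h x)"
    proof
      fix x
      have "(1 - 2 * \<theta> x) * h x = h x - 2 * g x" by (simp add: g_def algebra_simps)
      then show "?V x * g x - g x = (1 - 2 * \<theta> x) * h x" using gh[of x] by (simp add: algebra_simps)
    qed
    then show "(\<lambda>x. (1 - 2 * \<theta> x) * h x) \<in> H" "(nrm (\<lambda>x. (1 - 2 * \<theta> x) * h x))\<^sup>2
        = (nrm g)\<^sup>2 - 2 * Re (ip (\<lambda>x. ?V x * g x) g) + (nrm (\<lambda>x. ?V x * g x))\<^sup>2"
      using nrm_sq_diff[OF Vm[OF g] g] diff_mem[OF Vm[OF g] g] by simp_all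
  qed
  have bounds: "nrm (\<lambda>x. \<theta> x * h x) \<le> 1 * nrm h" "(\<lambda>x. \<theta> x * f x * h x) \<in> H"
      "nrm (\<lambda>x. \<theta> x * f x * h x) \<le> 1 * nrm h" "nrm (\<lambda>x. (1 - 2 * \<theta> x) * h x) \<le> 1 * nrm h"
    if h: "h \<in> H" for h
  proof -
    define g where "g = (\<lambda>x. \<theta> x * h x)"
    have g: "g \<in> H" unfolding g_def using h by (rule \<theta>m)
    note k = key[OF h g_def]
    have fg: "(\<lambda>x. \<theta> x * f x * h x) = (\<lambda>x. f x * g x)" by (simp add: g_def mult.left_commute mult.assoc)
    note A = acc[OF g] nrm_nonneg[OF h] zero_le_power2[of "nrm (\<lambda>x. ?V x * g x)"]
      zero_le_power2[of "nrm (\<lambda>x. f x * g x)"] zero_le_power2[of "nrm g"]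
    show "(\<lambda>x. \<theta> x * f x * h x) \<in> H" unfolding fg using g by (rule fm)
    have "(nrm g)\<^sup>2 \<le> (nrm h)\<^sup>2" "(nrm (\<lambda>x. f x * g x))\<^sup>2 \<le> (nrm h)\<^sup>2"
      "(nrm (\<lambda>x. (1 - 2 * \<theta> x) * h x))\<^sup>2 \<le> (nrm h)\<^sup>2"
      using k A by linarith+
    then show "nrm (\<lambda>x. \<theta> x * h x) \<le> 1 * nrm h" "nrm (\<lambda>x. \<theta> x * f x * h x) \<le> 1 * nrm h"
      "nrm (\<lambda>x. (1 - 2 * \<theta> x) * h x) \<le> 1 * nrm h"
      unfolding fg g_def[symmetric] using A(2) by (auto intro: power2_le_imp_le)
  qed
  show "mult_bound \<theta> 1" "mult_bound (\<lambda>x. \<theta> x * f x) 1" "mult_bound (\<lambda>x. 1 - 2 * \<theta> x) 1"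
    unfolding mult_bound_def by (intro conjI ballI zero_le_one \<theta>m key(3)[OF _ refl] bounds; assumption)+
qed

lemma mult_bound_limit:
  assumes "\<And>n. mult_bound (\<phi> n) C" "\<And>x. (\<lambda>n. \<phi> n x) \<longlonglongrightarrow> \<psi> x"
  shows "mult_bound \<psi> C"
  unfolding mult_bound_def
proof (intro conjI ballI)
  fix h assume h: "h \<in> H"
  have "(\<lambda>n. \<phi> n x * h x) \<longlonglongrightarrow> \<psi> x * h x" for x
    by (intro tendsto_mult tendsto_const assms(2))
  from pointwise_limit_mem[OF mult_bound_mem[OF assms(1) h] mult_bound_le[OF assms(1) h] this]
  show "(\<lambda>x. \<psi> x * h x) \<in> H" "nrm (\<lambda>x. \<psi> x * h x) \<le> C * nrm h" .
qed (use assms(1) in \<open>simp add: mult_bound_def\<close>)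

lemma sarason_tendsto:
  assumes F: "\<And>n. F n \<in> H" and f: "f \<in> H" and lim: "(\<lambda>n. nrm (\<lambda>x. F n x - f x)) \<longlonglongrightarrow> 0"
  shows "(\<lambda>n. sarason (F n) z) \<longlonglongrightarrow> sarason f z"
proof -
  obtain C where C: "mult_bound (\<lambda>x. k x z) C" using kernel_mult_bound by blast
  note m = mult_bound_mem[OF C]
  have "(\<lambda>n. ip (F n) (\<lambda>x. k x z * F n x)) \<longlonglongrightarrow> ip f (\<lambda>x. k x z * f x)"
  proof (rule LIM_zero_cancel, rule Lim_null_comparison)
    show "\<forall>\<^sub>F n in sequentially. norm (ip (F n) (\<lambda>x. k x z * F n x) - ip f (\<lambda>x. k x z * f x))
      \<le> nrm (\<lambda>x. F n x - f x) * (C * nrm (F n)) + nrm f * (C * nrm (\<lambda>x. F n x - f x))"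
    proof (rule always_eventually, rule allI)
      fix n
      define D where "D = (\<lambda>x. F n x - f x)"
      have D: "D \<in> H" unfolding D_def using F f by (rule diff_mem)
      have "(\<lambda>x. k x z * D x) = (\<lambda>x. k x z * F n x - k x z * f x)"
        by (simp add: D_def right_diff_distrib)
      then have "ip (F n) (\<lambda>x. k x z * F n x) - ip f (\<lambda>x. k x z * f x)
        = ip D (\<lambda>x. k x z * F n x) + ip f (\<lambda>x. k x z * D x)"
        using F f m[OF F] m[OF f] by (simp add: D_def ip_diff_left ip_diff_right)
      then have "norm (ip (F n) (\<lambda>x. k x z * F n x) - ip f (\<lambda>x. k x z * f x))
        \<le> nrm D * nrm (\<lambda>x. k x z * F n x) + nrm f * nrm (\<lambda>x. k x z * D x)"
        using norm_triangle_ineq[of "ip D (\<lambda>x. k x z * F n x)" "ip f (\<lambda>x. k x z * D x)"]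
          Cauchy_Schwarz[OF D m[OF F], of n] Cauchy_Schwarz[OF f m[OF D]] by simp
      also have "\<dots> \<le> nrm D * (C * nrm (F n)) + nrm f * (C * nrm D)"
        by (intro add_mono mult_left_mono mult_bound_le[OF C] nrm_nonneg D F f)
      finally show "norm (ip (F n) (\<lambda>x. k x z * F n x) - ip f (\<lambda>x. k x z * f x))
        \<le> nrm (\<lambda>x. F n x - f x) * (C * nrm (F n)) + nrm f * (C * nrm (\<lambda>x. F n x - f x))"
        unfolding D_def .
    qed
    have "(\<lambda>n. nrm (\<lambda>x. F n x - f x) * (C * nrm (F n)) + nrm f * (C * nrm (\<lambda>x. F n x - f x)))
      \<longlonglongrightarrow> 0 * (C * nrm f) + nrm f * (C * 0)"
      by (intro tendsto_intros lim nrm_tendsto[OF F f lim])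
    then show "(\<lambda>n. nrm (\<lambda>x. F n x - f x) * (C * nrm (F n)) + nrm f * (C * nrm (\<lambda>x. F n x - f x))) \<longlonglongrightarrow> 0"
      by simp
  qed
  then show ?thesis
    unfolding sarason_def by (intro tendsto_intros nrm_tendsto[OF F f lim])
qed

section \<open>Quotients of multipliers\<close>

text \<open>
  Every function in \<open>H\<close> is a quotient of multipliers whose denominator is zero-free. The resolvents
  belonging to approximants from the span of the kernel functions converge pointwise, and
  contractivity is preserved.
\<close>

lemma multiplier_denominator:
  assumes f: "f \<in> H"
  shows "\<exists>\<theta>\<in>Mult H. (\<lambda>x. \<theta> x * f x) \<in> Mult H \<and> mult_bound (\<lambda>x. 1 - 2 * \<theta> x) 1 \<and> (\<forall>x. \<theta> x \<noteq> 0)"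
proof -
  obtain Z a where Z: "\<And>n. finite (Z n)"
    and lim: "(\<lambda>n. nrm (\<lambda>x. (\<Sum>w\<in>Z n. a n w * k x w) - f x)) \<longlonglongrightarrow> 0"
    using kernel_span_dense[OF f] by blast
  define F where "F n = (\<lambda>x. \<Sum>w\<in>Z n. a n w * k x w)" for n
  have F: "F n \<in> H" for n unfolding F_def by (intro sum_mem scale_mem kernel_mem)
  have limF: "(\<lambda>n. nrm (\<lambda>x. F n x - f x)) \<longlonglongrightarrow> 0" using lim by (simp add: F_def)
  note V = sarason_tendsto[OF F f limF]
  note res = sarason_resolvent[OF Z F_def]
  have ReV: "0 \<le> Re (sarason f x)" for x
    using tendsto_Re[OF V[of x]] res(1) by (intro LIMSEQ_le_const) auto
  have V1: "1 + sarason f x \<noteq> 0" for x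
  proof
    assume "1 + sarason f x = 0"
    then have "Re (1 + sarason f x) = 0" by simp
    then show False using ReV[of x] by simp
  qed
  define \<theta> where "\<theta> x = 1 / (1 + sarason f x)" for x
  have lim\<theta>: "(\<lambda>n. 1 / (1 + sarason (F n) x)) \<longlonglongrightarrow> \<theta> x" for x
    unfolding \<theta>_def by (intro tendsto_intros V V1)
  have "mult_bound \<theta> 1" using res(2) lim\<theta> by (rule mult_bound_limit)
  moreover have "mult_bound (\<lambda>x. \<theta> x * f x) 1"
    using res(3) tendsto_mult[OF lim\<theta> eval_tendsto[OF F f limF]] by (rule mult_bound_limit)
  moreover have "(\<lambda>n. 1 - 2 * (1 / (1 + sarason (F n) x))) \<longlonglongrightarrow> 1 - 2 * \<theta> x" for x
    by (intro tendsto_intros lim\<theta>)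
  with res(4) have "mult_bound (\<lambda>x. 1 - 2 * \<theta> x) 1" by (rule mult_bound_limit)
  moreover have "\<theta> x \<noteq> 0" for x using V1 by (simp add: \<theta>_def)
  ultimately show ?thesis using mult_bound_Mult by blast
qed

text \<open>
  If \<open>\<rho> \<theta> = 0\<close>, then \<open>\<rho>\<close> takes the same value at \<open>h\<close> and at \<open>(1 - 2\<theta>) h\<close>. As \<open>1 - 2\<theta>\<close>
  is contractive, it must fix the unique vector \<open>u\<close> of least norm with \<open>\<rho> u = 1\<close>. This
  forces \<open>\<theta> u = 0\<close> and hence \<open>u = 0\<close>.
\<close>

lemma functional_denominator:
  assumes \<rho>: "bounded_linear_functional H ip \<rho>" and \<rho>1: "\<rho> (\<lambda>x. 1) \<noteq> 0"
    and mult: "\<And>h. h \<in> H \<Longrightarrow> \<rho> (\<lambda>x. \<theta> x * h x) = \<rho> \<theta> * \<rho> h"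
    and \<theta>: "\<theta> \<in> Mult H" "mult_bound (\<lambda>x. 1 - 2 * \<theta> x) 1" "\<And>x. \<theta> x \<noteq> 0"
  shows "\<rho> \<theta> \<noteq> 0"
proof
  assume 0: "\<rho> \<theta> = 0"
  have add: "\<rho> (\<lambda>x. f x + g x) = \<rho> f + \<rho> g" if "f \<in> H" "g \<in> H" for f g
    using \<rho> that by (simp add: bounded_linear_functional_def)
  have scale: "\<rho> (\<lambda>x. c * f x) = c * \<rho> f" if "f \<in> H" for c f
    using \<rho> that by (simp add: bounded_linear_functional_def)
  obtain C where C: "\<And>f. f \<in> H \<Longrightarrow> cmod (\<rho> f) \<le> C * nrm f"
    using \<rho> unfolding bounded_linear_functional_def by blast
  have diff: "\<rho> (\<lambda>x. f x - g x) = \<rho> f - \<rho> g" if "f \<in> H" "g \<in> H" for f g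
    using add[OF that(1) scale_mem[OF that(2), of "-1"]] scale[OF that(2), of "-1"] by simp
  define A where "A (n::nat) = {f \<in> H. \<rho> f = 1}" for n
  have midA: "(\<lambda>x. (f x + g x) / 2) \<in> A n" if "f \<in> A n" "g \<in> A n" for f g n
    using that scale[OF add_mem, of f g "1/2"] by (simp add: A_def midpoint_mem add)
  \<comment> \<open>A vector on which \<open>\<rho>\<close> is \<open>1\<close>, so that the sets \<open>A n\<close> contain a vector of bounded norm.\<close>
  define e where "e = (\<lambda>x::'x. (1 / \<rho> (\<lambda>x. 1)) * 1)"
  have eA: "e \<in> A n" for n
    using \<rho>1 scale[OF one_mem, of "1 / \<rho> (\<lambda>x. 1)"] scale_mem[OF one_mem, of "1 / \<rho> (\<lambda>x. 1)"]
    by (simp add: A_def e_def)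
  obtain F u where FA: "\<And>n. F n \<in> A n" and u: "u \<in> H" "(\<lambda>n. nrm (\<lambda>x. F n x - u x)) \<longlonglongrightarrow> 0"
    and umin: "\<And>w. w \<in> A 0 \<Longrightarrow> nrm u \<le> nrm w"
  proof (rule nested_minimal_norm[of A "nrm e"])
    show "\<exists>f\<in>A n. nrm f \<le> nrm e" for n using eA by blast
  qed (use midA in \<open>auto simp: A_def\<close>)
  have FH: "F n \<in> H" and F1: "\<rho> (F n) = 1" for n using FA[of n] by (auto simp: A_def)
  have "(\<lambda>n. 1 - \<rho> u) \<longlonglongrightarrow> 0"
  proof (rule Lim_null_comparison)
    show "\<forall>\<^sub>F n in sequentially. norm (1 - \<rho> u) \<le> C * nrm (\<lambda>x. F n x - u x)"
      using C[OF diff_mem[OF FH u(1)]] diff[OF FH u(1)] F1 by simp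
    show "(\<lambda>n. C * nrm (\<lambda>x. F n x - u x)) \<longlonglongrightarrow> 0"
      using u(2) by (rule tendsto_mult_right_zero)
  qed
  then have \<rho>u: "\<rho> u = 1" using LIMSEQ_unique[OF tendsto_const] by force
  define v where "v = (\<lambda>x. (1 - 2 * \<theta> x) * u x)"
  have \<theta>u: "(\<lambda>x. \<theta> x * u x) \<in> H" using \<theta>(1) u(1) by (simp add: Mult_def)
  have v: "v \<in> H" "nrm v \<le> nrm u"
    using mult_bound_mem[OF \<theta>(2) u(1)] mult_bound_le[OF \<theta>(2) u(1)] by (simp_all add: v_def)
  have v_eq: "v = (\<lambda>x. u x - 2 * (\<theta> x * u x))" by (simp add: v_def algebra_simps)
  have "\<rho> v = 1"
    unfolding v_eq using diff[OF u(1) scale_mem[OF \<theta>u]] scale[OF \<theta>u] mult[OF u(1)] \<rho>u 0 by simp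
  then have "(\<lambda>x. (u x + v x) / 2) \<in> A 0" using u(1) v(1) \<rho>u by (intro midA) (auto simp: A_def)
  then have "(nrm u)\<^sup>2 \<le> (nrm (\<lambda>x. (u x + v x) / 2))\<^sup>2"
    using nrm_nonneg[OF u(1)] by (intro power_mono umin)
  moreover have "(nrm v)\<^sup>2 \<le> (nrm u)\<^sup>2" using v nrm_nonneg by (intro power_mono) auto
  ultimately have "(nrm (\<lambda>x. u x - v x))\<^sup>2 \<le> 0" using parallelogram[OF u(1) v(1)] by linarith
  then have "nrm (\<lambda>x. u x - v x) = 0" by simp
  then have "(\<lambda>x. u x - v x) = (\<lambda>x. 0)" using nrm_eq_0 diff_mem[OF u(1) v(1)] by blast
  then have "2 * (\<theta> x * u x) = 0" for x by (simp add: v_eq fun_eq_iff)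
  then have "u = (\<lambda>x. 0 * u x)" using \<theta>(3) by (simp add: fun_eq_iff)
  then have "\<rho> u = 0" using scale[OF u(1), of 0] by simp
  then show False using \<rho>u by simp
qed

end

section \<open>Functionals multiplicative on multipliers\<close>

theorem corollary1p3:
  fixes H :: "('x \<Rightarrow> complex) set"
    and ip :: "('x \<Rightarrow> complex) \<Rightarrow> ('x \<Rightarrow> complex) \<Rightarrow> complex"
    and k :: "'x \<Rightarrow> 'x \<Rightarrow> complex"
    and \<rho> :: "('x \<Rightarrow> complex) \<Rightarrow> complex"
  assumes "complete_pick_space H ip k"
    and "normalized_kernel k"
    and "bounded_linear_functional H ip \<rho>"
    and "\<exists>f\<in>H. \<rho> f \<noteq> 0"
  shows "(\<forall>\<phi>\<in>Mult H. \<forall>g\<in>H. \<rho> (\<lambda>x. \<phi> x * g x) = \<rho> \<phi> * \<rho> g) \<longleftrightarrow>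
         (\<forall>f\<in>H. \<forall>g\<in>H. (\<lambda>x. f x * g x) \<in> H \<longrightarrow> \<rho> (\<lambda>x. f x * g x) = \<rho> f * \<rho> g)"
proof -
  obtain x0 where "\<And>x. k x x0 = 1"
    using assms(2) by (auto simp: normalized_kernel_def)
  with assms(1) interpret normalized_pick_space H ip k x0
    by (simp add: normalized_pick_space_def normalized_pick_space_axioms_def)
  have MH: "\<phi> \<in> H" if "\<phi> \<in> Mult H" for \<phi> using Mult_subset[OF assms(2)] that by blast
  show ?thesis
  proof
    assume i: "\<forall>\<phi>\<in>Mult H. \<forall>g\<in>H. \<rho> (\<lambda>x. \<phi> x * g x) = \<rho> \<phi> * \<rho> g"
    have one: "(\<lambda>x. 1) \<in> Mult H" by (simp add: Mult_def)
    obtain f0 where "f0 \<in> H" "\<rho> f0 \<noteq> 0" using assms(4) by blast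
    then have \<rho>1: "\<rho> (\<lambda>x. 1) \<noteq> 0" using bspec[OF bspec[OF i one], of f0] by auto
    show "\<forall>f\<in>H. \<forall>g\<in>H. (\<lambda>x. f x * g x) \<in> H \<longrightarrow> \<rho> (\<lambda>x. f x * g x) = \<rho> f * \<rho> g"
    proof (intro ballI impI)
      fix f g assume f: "f \<in> H" and g: "g \<in> H" and fg: "(\<lambda>x. f x * g x) \<in> H"
      obtain \<theta> where \<theta>: "\<theta> \<in> Mult H" "(\<lambda>x. \<theta> x * f x) \<in> Mult H" "mult_bound (\<lambda>x. 1 - 2 * \<theta> x) 1"
        "\<And>x. \<theta> x \<noteq> 0" using multiplier_denominator[OF f] by blast
      obtain \<eta> where \<eta>: "\<eta> \<in> Mult H" "(\<lambda>x. \<eta> x * g x) \<in> Mult H" "mult_bound (\<lambda>x. 1 - 2 * \<eta> x) 1"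
        "\<And>x. \<eta> x \<noteq> 0" using multiplier_denominator[OF g] by blast
      have nz: "\<rho> \<theta> \<noteq> 0" "\<rho> \<eta> \<noteq> 0"
        using functional_denominator[OF assms(3) \<rho>1] i \<theta> \<eta> by blast+
      have \<eta>fg: "(\<lambda>x. \<eta> x * (f x * g x)) \<in> H" using \<eta>(1) fg by (simp add: Mult_def)
      \<comment> \<open>Both denominators are cleared, and \<open>\<rho> (\<theta> f \<eta> g)\<close> is evaluated in two ways.\<close>
      have "\<rho> \<theta> * (\<rho> \<eta> * \<rho> (\<lambda>x. f x * g x)) = \<rho> (\<lambda>x. \<theta> x * (\<eta> x * (f x * g x)))"
        using i \<theta>(1) \<eta>(1) fg \<eta>fg by simp
      also have "\<dots> = \<rho> (\<lambda>x. (\<theta> x * f x) * (\<eta> x * g x))" by (simp add: mult.left_commute mult.assoc)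
      also have "\<dots> = \<rho> (\<lambda>x. \<theta> x * f x) * \<rho> (\<lambda>x. \<eta> x * g x)"
        using bspec[OF bspec[OF i \<theta>(2)] MH[OF \<eta>(2)]] .
      also have "\<dots> = (\<rho> \<theta> * \<rho> f) * (\<rho> \<eta> * \<rho> g)" using i \<theta>(1) \<eta>(1) f g by simp
      finally show "\<rho> (\<lambda>x. f x * g x) = \<rho> f * \<rho> g" using nz by simp
    qed
  next
    assume ii: "\<forall>f\<in>H. \<forall>g\<in>H. (\<lambda>x. f x * g x) \<in> H \<longrightarrow> \<rho> (\<lambda>x. f x * g x) = \<rho> f * \<rho> g"
    show "\<forall>\<phi>\<in>Mult H. \<forall>g\<in>H. \<rho> (\<lambda>x. \<phi> x * g x) = \<rho> \<phi> * \<rho> g"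
    proof (intro ballI)
      fix \<phi> g assume \<phi>: "\<phi> \<in> Mult H" and g: "g \<in> H"
      have "(\<lambda>x. \<phi> x * g x) \<in> H" using \<phi> g by (simp add: Mult_def)
      then show "\<rho> (\<lambda>x. \<phi> x * g x) = \<rho> \<phi> * \<rho> g"
        by (rule ii[rule_format, OF MH[OF \<phi>] g])
    qed
  qed
qed

end
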